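(* Let $\mathcal{C}$ be a strict monoidal category and $J$ an object of $\mathcal{C}$. Let $\mathcal{C}[J^{\vee}]$ be the strict monoidal category obtained by freely adjoining a right dual $J^{\vee}$ to $J$ (as constructed in the context). Then the inclusion functor $\Omega : \mathcal{C} \to \mathcal{C}[J^{\vee}]$ is fully faithful.
   Context: Construction of $\mathcal{C}[J^{\vee}]$. Let $\mathcal{C}$ be a strict monoidal category with tensor $\otimes$ and unit $\mathbb{I}$, and let $J\in\mathcal{C}$. Write $[m]=\{0,1,\dots,m\}$. Let $\mathcal{G}_0$ be the set of all functions $U:[m]\to \mathrm{ob}\,\mathcal{C}$ ($m\ge 0$), written $U=(U_0,\dots,U_m)$; objects of $\mathcal{C}$ are identified with functions $[0]\to\mathrm{ob}\,\mathcal{C}$. For $U:[m]\to\mathrm{ob}\,\mathcal{C}$ and $V:[n]\to\mathrm{ob}\,\mathcal{C}$ define $U\otimes V:[m+n]\to\mathrm{ob}\,\mathcal{C}$ by $(U\otimes V)_i=U_i$ for $i<m$, $(U\otimes V)_m=U_m\otimes V_0$, $(U\otimes V)_i=V_{i-m}$ for $i>m$. This makes $\mathcal{G}_0$ a monoid with unit $\mathbb{I}$. Put $J^{\vee}=(\mathbb{I},\mathbb{I}):[1]\to\mathrm{ob}\,\mathcal{C}$; then every $U$ decomposes uniquely as $U=U_0\otimes J^{\vee}\otimes U_1\otimes J^{\vee}\otimes\dots\otimes J^{\vee}\otimes U_m$ with $U_i\in\mathcal{C}$. Let $\mathcal{G}$ be the directed graph with vertex set $\mathcal{G}_0$ and the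 following edges. The primitive edges are symbols $\varepsilon: J\otimes J^{\vee}\to\mathbb{I}$, $\eta:\mathbb{I}\to J^{\vee}\otimes J$, and $\bar f: C\to D$ for each morphism $f:C\to D$ of $\mathcal{C}$. The general edges are the formal whiskerings $U\otimes p\otimes V: U\otimes A\otimes V\to U\otimes B\otimes V$ with $p:A\to B$ primitive and $U,V\in\mathcal{G}_0$ (with $p$ identified with $\mathbb{I}\otimes p\otimes\mathbb{I}$); put $T\otimes(U\otimes p\otimes V)\otimes W=(T\otimes U)\otimes p\otimes(V\otimes W)$ and extend $U\otimes -\otimes V$ to paths edge by edge. Let $\mathcal{F}\mathcal{G}$ be the free category on $\mathcal{G}$, and let $\sim$ be the congruence on $\mathcal{F}\mathcal{G}$ generated by the following relations ($C,D,E,F\in\mathcal{C}$; $U,V,W,X,Y,Z\in\mathcal{G}_0$): (i) $\overline{E\otimes f\otimes F}\sim E\otimes\bar f\otimes F$ for $f\in\mathcal{C}(C,D)$; (ii) $\overline{1_C}\sim 1_C$, and $\overline{gf}\sim\bar g\,\bar f$ for $f\in\mathcal{C}(C,D)$, $g\in\mathcal{C}(D,E)$; (iii) $(V\otimes b)(a\otimes W)\sim(a\otimes X)(U\otimes b)$ for all edges $a:U\to V$, $b:W\to X$; (iv) $(\varepsilon\otimes J)(J\otimes\eta)\sim 1_J$; (v) $(J^{\vee}\otimes\varepsilon)(\eta\otimes J^{\vee})\sim 1_{J^{\vee}}$; (vi) if $\ell\sim\ell'$ is any of the relations (i)–(v), then $Y\otimes\ell\otimes Z\sim Y\otimes\ell'\otimes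 Z$. Put $\mathcal{C}[J^{\vee}]=\mathcal{F}\mathcal{G}/\sim$. It is strict monoidal: the tensor of objects $U:[m]\to\mathrm{ob}\,\mathcal{C}$ and $V:[n]\to\mathrm{ob}\,\mathcal{C}$ is the product in the monoid $\mathcal{G}_0$, i.e. the function $U\otimes V:[m+n]\to\mathrm{ob}\,\mathcal{C}$ with $(U\otimes V)_i=U_i$ for $i<m$, $(U\otimes V)_m=U_m\otimes V_0$, $(U\otimes V)_i=V_{i-m}$ for $i>m$, and for morphisms $[a]\otimes[b]$ is the class of both sides of (iii), extended to paths. The functor $\Omega:\mathcal{C}\to\mathcal{C}[J^{\vee}]$, $\Omega C=C$, $\Omega f=[\bar f]$, is strict monoidal, and $J\dashv J^{\vee}$ in $\mathcal{C}[J^{\vee}]$ with counit $\varepsilon$ and unit $\eta$. *)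

theory Defs
  imports "Graph_Theory.Arc_Walk"
begin

section \<open>Strict monoidal categories\<close>

record ('o, 'm) cat =
  Ob :: "'o set"
  Ar :: "'m set"
  Dom :: "'m \<Rightarrow> 'o"
  Cod :: "'m \<Rightarrow> 'o"
  Id :: "'o \<Rightarrow> 'm"
  Comp :: "'m \<Rightarrow> 'm \<Rightarrow> 'm" (infixl "\<cdot>\<index>" 65)

text \<open>As usual, \<open>g \<cdot> f\<close> is "first \<open>f\<close>, then \<open>g\<close>".\<close>

record ('o, 'm) mon_cat = "('o, 'm) cat" +
  Unit :: "'o" ("\<I>\<index>")
  TensO :: "'o \<Rightarrow> 'o \<Rightarrow> 'o" (infixl "\<otimes>\<index>" 70)
  TensA :: "'m \<Rightarrow> 'm \<Rightarrow> 'm" (infixl "\<boxtimes>\<index>" 70)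

definition hom :: "('o, 'm, 'x) cat_scheme \<Rightarrow> 'o \<Rightarrow> 'o \<Rightarrow> 'm set" where
  "hom C A B = {f \<in> Ar C. Dom C f = A \<and> Cod C f = B}"

locale category =
  fixes C :: "('o, 'm, 'x) cat_scheme" (structure)
  assumes Dom_in: "f \<in> Ar C \<Longrightarrow> Dom C f \<in> Ob C"
    and Cod_in: "f \<in> Ar C \<Longrightarrow> Cod C f \<in> Ob C"
    and Id_in: "A \<in> Ob C \<Longrightarrow> Id C A \<in> hom C A A"
    and Comp_in: "f \<in> hom C A B \<Longrightarrow> g \<in> hom C B D \<Longrightarrow> g \<cdot> f \<in> hom C A D"
    and Id_right: "f \<in> hom C A B \<Longrightarrow> f \<cdot> Id C A = f"
    and Id_left: "f \<in> hom C A B \<Longrightarrow> Id C B \<cdot> f = f"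
    and Comp_assoc: "f \<in> hom C A B \<Longrightarrow> g \<in> hom C B D \<Longrightarrow> h \<in> hom C D E \<Longrightarrow>
      h \<cdot> g \<cdot> f = h \<cdot> (g \<cdot> f)"

locale strict_monoidal_category = category C
  for C :: "('o, 'm, 'x) mon_cat_scheme" (structure) +
  assumes Unit_in: "\<I> \<in> Ob C"
    and TensO_in: "A \<in> Ob C \<Longrightarrow> B \<in> Ob C \<Longrightarrow> A \<otimes> B \<in> Ob C"
    and TensO_assoc: "A \<in> Ob C \<Longrightarrow> B \<in> Ob C \<Longrightarrow> D \<in> Ob C \<Longrightarrow> A \<otimes> B \<otimes> D = A \<otimes> (B \<otimes> D)"
    and TensO_unit_left: "A \<in> Ob C \<Longrightarrow> \<I> \<otimes> A = A"
    and TensO_unit_right: "A \<in> Ob C \<Longrightarrow> A \<otimes> \<I> = A"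
    and TensA_in: "f \<in> hom C A B \<Longrightarrow> g \<in> hom C A' B' \<Longrightarrow> f \<boxtimes> g \<in> hom C (A \<otimes> A') (B \<otimes> B')"
    and TensA_Id: "A \<in> Ob C \<Longrightarrow> B \<in> Ob C \<Longrightarrow> Id C A \<boxtimes> Id C B = Id C (A \<otimes> B)"
    and TensA_Comp: "f \<in> hom C A B \<Longrightarrow> g \<in> hom C B D \<Longrightarrow> f' \<in> hom C A' B' \<Longrightarrow> g' \<in> hom C B' D' \<Longrightarrow>
      (g \<cdot> f) \<boxtimes> (g' \<cdot> f') = (g \<boxtimes> g') \<cdot> (f \<boxtimes> f')"
    and TensA_assoc: "f \<in> Ar C \<Longrightarrow> g \<in> Ar C \<Longrightarrow> h \<in> Ar C \<Longrightarrow> f \<boxtimes> g \<boxtimes> h = f \<boxtimes> (g \<boxtimes> h)"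
    and TensA_unit_left: "f \<in> Ar C \<Longrightarrow> Id C \<I> \<boxtimes> f = f"
    and TensA_unit_right: "f \<in> Ar C \<Longrightarrow> f \<boxtimes> Id C \<I> = f"


section \<open>Functors\<close>

text \<open>A functor is given by its action \<open>Fo\<close> on objects and its action \<open>Fa\<close> on arrows.\<close>

locale cat_functor = dom: category C + cod: category D
  for C :: "('o, 'm, 'x) cat_scheme" and D :: "('p, 'n, 'y) cat_scheme"
    and Fo :: "'o \<Rightarrow> 'p" and Fa :: "'m \<Rightarrow> 'n" +
  assumes Fo_in: "A \<in> Ob C \<Longrightarrow> Fo A \<in> Ob D"
    and Fa_in: "f \<in> hom C A B \<Longrightarrow> Fa f \<in> hom D (Fo A) (Fo B)"
    and Fa_Id: "A \<in> Ob C \<Longrightarrow> Fa (Id C A) = Id D (Fo A)"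
    and Fa_Comp: "f \<in> hom C A B \<Longrightarrow> g \<in> hom C B E \<Longrightarrow> Fa (g \<cdot>\<^bsub>C\<^esub> f) = Fa g \<cdot>\<^bsub>D\<^esub> Fa f"

locale strict_monoidal_functor =
  cat_functor C D Fo Fa + dom: strict_monoidal_category C + cod: strict_monoidal_category D
  for C :: "('o, 'm, 'x) mon_cat_scheme" and D :: "('p, 'n, 'y) mon_cat_scheme"
    and Fo :: "'o \<Rightarrow> 'p" and Fa :: "'m \<Rightarrow> 'n" +
  assumes Fo_Unit: "Fo \<I>\<^bsub>C\<^esub> = \<I>\<^bsub>D\<^esub>"
    and Fo_TensO: "A \<in> Ob C \<Longrightarrow> B \<in> Ob C \<Longrightarrow> Fo (A \<otimes>\<^bsub>C\<^esub> B) = Fo A \<otimes>\<^bsub>D\<^esub> Fo B"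
    and Fa_TensA: "f \<in> Ar C \<Longrightarrow> g \<in> Ar C \<Longrightarrow> Fa (f \<boxtimes>\<^bsub>C\<^esub> g) = Fa f \<boxtimes>\<^bsub>D\<^esub> Fa g"

definition fully_faithful_functor ::
    "('o, 'm, 'x) cat_scheme \<Rightarrow> ('p, 'n, 'y) cat_scheme \<Rightarrow> ('o \<Rightarrow> 'p) \<Rightarrow> ('m \<Rightarrow> 'n) \<Rightarrow> bool" where
  "fully_faithful_functor C D Fo Fa \<longleftrightarrow> cat_functor C D Fo Fa \<and>
    (\<forall>A \<in> Ob C. \<forall>B \<in> Ob C. bij_betw Fa (hom C A B) (hom D (Fo A) (Fo B)))"

text \<open>\<open>R\<close> is right dual to \<open>L\<close>, i.e. \<open>L \<stileturn> R\<close>, with counit \<open>e : L \<otimes> R \<rightarrow> \<I>\<close>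
  and unit \<open>h : \<I> \<rightarrow> R \<otimes> L\<close>.\<close>

definition right_dual :: "('o, 'm, 'x) mon_cat_scheme \<Rightarrow> 'o \<Rightarrow> 'o \<Rightarrow> 'm \<Rightarrow> 'm \<Rightarrow> bool" where
  "right_dual C L R e h \<longleftrightarrow> L \<in> Ob C \<and> R \<in> Ob C \<and>
    e \<in> hom C (L \<otimes>\<^bsub>C\<^esub> R) \<I>\<^bsub>C\<^esub> \<and> h \<in> hom C \<I>\<^bsub>C\<^esub> (R \<otimes>\<^bsub>C\<^esub> L) \<and>
    (e \<boxtimes>\<^bsub>C\<^esub> Id C L) \<cdot>\<^bsub>C\<^esub> (Id C L \<boxtimes>\<^bsub>C\<^esub> h) = Id C L \<and>
    (Id C R \<boxtimes>\<^bsub>C\<^esub> e) \<cdot>\<^bsub>C\<^esub> (h \<boxtimes>\<^bsub>C\<^esub> Id C R) = Id C R"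


section \<open>Free categories, congruences, quotients\<close>

text \<open>An arrow of the free category is a directed walk, stored as source vertex, list of edges
  in the order in which they are traversed, and target vertex.\<close>

type_synonym ('v, 'e) path = "'v \<times> 'e list \<times> 'v"

definition free_category :: "('v, 'e) pre_digraph \<Rightarrow> ('v, ('v, 'e) path) cat" where
  "free_category G =
    \<lparr>Ob = verts G,
     Ar = {(u, es, v). pre_digraph.awalk G u es v},
     Dom = (\<lambda>(u, es, v). u),
     Cod = (\<lambda>(u, es, v). v),
     Id = (\<lambda>u. (u, [], u)),
     Comp = (\<lambda>(v', fs, w) (u, es, v). (u, es @ fs, w))\<rparr>"

inductive_set congruence_closure :: "('o, 'm, 'x) cat_scheme \<Rightarrow> ('m \<times> 'm) set \<Rightarrow> ('m \<times> 'm) set"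
  for K :: "('o, 'm, 'x) cat_scheme" and R :: "('m \<times> 'm) set" where
  incl: "(p, q) \<in> R \<Longrightarrow> (p, q) \<in> congruence_closure K R"
| refl: "p \<in> Ar K \<Longrightarrow> (p, p) \<in> congruence_closure K R"
| sym: "(p, q) \<in> congruence_closure K R \<Longrightarrow> (q, p) \<in> congruence_closure K R"
| trans: "(p, q) \<in> congruence_closure K R \<Longrightarrow> (q, r) \<in> congruence_closure K R \<Longrightarrow>
    (p, r) \<in> congruence_closure K R"
| comp: "(p, p') \<in> congruence_closure K R \<Longrightarrow> (q, q') \<in> congruence_closure K R \<Longrightarrow>
    Cod K p = Dom K q \<Longrightarrow> (q \<cdot>\<^bsub>K\<^esub> p, q' \<cdot>\<^bsub>K\<^esub> p') \<in> congruence_closure K R"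

text \<open>The operation on equivalence classes induced by a binary operation on representatives.\<close>

definition class_op :: "('m \<times> 'm) set \<Rightarrow> ('m \<Rightarrow> 'm \<Rightarrow> 'm) \<Rightarrow> 'm set \<Rightarrow> 'm set \<Rightarrow> 'm set" where
  "class_op r f X Y = (\<Union>x \<in> X. \<Union>y \<in> Y. r `` {f x y})"

definition quotient_category :: "('o, 'm, 'x) cat_scheme \<Rightarrow> ('m \<times> 'm) set \<Rightarrow> ('o, 'm set) cat" where
  "quotient_category K r =
    \<lparr>Ob = Ob K,
     Ar = Ar K // r,
     Dom = (\<lambda>X. the_elem (Dom K ` X)),
     Cod = (\<lambda>X. the_elem (Cod K ` X)),
     Id = (\<lambda>A. r `` {Id K A}),
     Comp = class_op r (Comp K)\<rparr>"


section \<open>Freely adjoining a right dual\<close>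

text \<open>A function \<open>U : [m] \<rightarrow> ob C\<close> is the nonempty list \<open>[U\<^sub>0, \<dots>, U\<^sub>m]\<close>; an object \<open>A\<close> of \<open>C\<close> is
  identified with the singleton \<open>[A]\<close>.\<close>

definition obj_lists :: "('o, 'm, 'x) mon_cat_scheme \<Rightarrow> 'o list set" where
  "obj_lists C = {U. U \<noteq> [] \<and> set U \<subseteq> Ob C}"

definition ltens :: "('o, 'm, 'x) mon_cat_scheme \<Rightarrow> 'o list \<Rightarrow> 'o list \<Rightarrow> 'o list"
    (infixl "\<odot>\<index>" 70) where
  "U \<odot>\<^bsub>C\<^esub> V = butlast U @ [last U \<otimes>\<^bsub>C\<^esub> hd V] @ tl V"

lemma length_ltens:
  assumes "length U = Suc m" "length V = Suc n"
  shows "length (U \<odot>\<^bsub>C\<^esub> V) = Suc (m + n)"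
  using assms by (simp add: ltens_def)

lemma nth_ltens:
  assumes "length U = Suc m" "length V = Suc n" "i \<le> m + n"
  shows "(U \<odot>\<^bsub>C\<^esub> V) ! i =
    (if i < m then U ! i else if i = m then U ! m \<otimes>\<^bsub>C\<^esub> V ! 0 else V ! (i - m))"
proof -
  have "U \<noteq> []" "V \<noteq> []" using assms by auto
  then show ?thesis using assms
    by (auto simp: ltens_def nth_append nth_butlast last_conv_nth hd_conv_nth nth_tl nth_Cons'
        intro!: arg_cong[where f = "(!) V"])
qed

definition Jdual :: "('o, 'm, 'x) mon_cat_scheme \<Rightarrow> 'o list" where
  "Jdual C = [\<I>\<^bsub>C\<^esub>, \<I>\<^bsub>C\<^esub>]"

datatype 'm prim = Eps | Eta | Bar 'm

definition prims :: "('o, 'm, 'x) mon_cat_scheme \<Rightarrow> 'm prim set" where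
  "prims C = {Eps, Eta} \<union> Bar ` Ar C"

fun prim_dom :: "('o, 'm, 'x) mon_cat_scheme \<Rightarrow> 'o \<Rightarrow> 'm prim \<Rightarrow> 'o list" where
  "prim_dom C J Eps = [J] \<odot>\<^bsub>C\<^esub> Jdual C"
| "prim_dom C J Eta = [\<I>\<^bsub>C\<^esub>]"
| "prim_dom C J (Bar f) = [Dom C f]"

fun prim_cod :: "('o, 'm, 'x) mon_cat_scheme \<Rightarrow> 'o \<Rightarrow> 'm prim \<Rightarrow> 'o list" where
  "prim_cod C J Eps = [\<I>\<^bsub>C\<^esub>]"
| "prim_cod C J Eta = Jdual C \<odot>\<^bsub>C\<^esub> [J]"
| "prim_cod C J (Bar f) = [Cod C f]"

text \<open>The triple \<open>(U, p, V)\<close> is the formal whiskering \<open>U \<otimes> p \<otimes> V\<close>.\<close>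

type_synonym ('o, 'm) edge = "'o list \<times> 'm prim \<times> 'o list"

definition dual_graph :: "('o, 'm, 'x) mon_cat_scheme \<Rightarrow> 'o \<Rightarrow> ('o list, ('o, 'm) edge) pre_digraph" where
  "dual_graph C J =
    \<lparr>verts = obj_lists C,
     arcs = obj_lists C \<times> prims C \<times> obj_lists C,
     tail = (\<lambda>(U, p, V). U \<odot>\<^bsub>C\<^esub> prim_dom C J p \<odot>\<^bsub>C\<^esub> V),
     head = (\<lambda>(U, p, V). U \<odot>\<^bsub>C\<^esub> prim_cod C J p \<odot>\<^bsub>C\<^esub> V)\<rparr>"

abbreviation dual_paths ::
    "('o, 'm, 'x) mon_cat_scheme \<Rightarrow> 'o \<Rightarrow> ('o list, ('o list, ('o, 'm) edge) path) cat" where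
  "dual_paths C J \<equiv> free_category (dual_graph C J)"

definition prim_edge :: "('o, 'm, 'x) mon_cat_scheme \<Rightarrow> 'm prim \<Rightarrow> ('o, 'm) edge" where
  "prim_edge C p = ([\<I>\<^bsub>C\<^esub>], p, [\<I>\<^bsub>C\<^esub>])"

definition edge_path ::
    "('o, 'm, 'x) mon_cat_scheme \<Rightarrow> 'o \<Rightarrow> ('o, 'm) edge \<Rightarrow> ('o list, ('o, 'm) edge) path" where
  "edge_path C J a = (tail (dual_graph C J) a, [a], head (dual_graph C J) a)"

abbreviation prim_path ::
    "('o, 'm, 'x) mon_cat_scheme \<Rightarrow> 'o \<Rightarrow> 'm prim \<Rightarrow> ('o list, ('o, 'm) edge) path" where
  "prim_path C J p \<equiv> edge_path C J (prim_edge C p)"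

definition whisker_edge ::
    "('o, 'm, 'x) mon_cat_scheme \<Rightarrow> 'o list \<Rightarrow> ('o, 'm) edge \<Rightarrow> 'o list \<Rightarrow> ('o, 'm) edge" where
  "whisker_edge C T a W = (case a of (U, p, V) \<Rightarrow> (T \<odot>\<^bsub>C\<^esub> U, p, V \<odot>\<^bsub>C\<^esub> W))"

definition whisker ::
    "('o, 'm, 'x) mon_cat_scheme \<Rightarrow> 'o list \<Rightarrow> ('o list, ('o, 'm) edge) path \<Rightarrow> 'o list
      \<Rightarrow> ('o list, ('o, 'm) edge) path" where
  "whisker C T p W = (case p of (u, es, v) \<Rightarrow>
    (T \<odot>\<^bsub>C\<^esub> u \<odot>\<^bsub>C\<^esub> W, map (\<lambda>a. whisker_edge C T a W) es, T \<odot>\<^bsub>C\<^esub> v \<odot>\<^bsub>C\<^esub> W))"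

abbreviation lwhisker where "lwhisker C T p \<equiv> whisker C T p [\<I>\<^bsub>C\<^esub>]"
abbreviation rwhisker where "rwhisker C p W \<equiv> whisker C [\<I>\<^bsub>C\<^esub>] p W"

inductive_set dual_rel_base ::
    "('o, 'm, 'x) mon_cat_scheme \<Rightarrow> 'o \<Rightarrow> (('o list, ('o, 'm) edge) path \<times> ('o list, ('o, 'm) edge) path) set"
  for C :: "('o, 'm, 'x) mon_cat_scheme" and J :: 'o where
  bar_whisker: "E \<in> Ob C \<Longrightarrow> F \<in> Ob C \<Longrightarrow> f \<in> Ar C \<Longrightarrow>
    (prim_path C J (Bar (Id C E \<boxtimes>\<^bsub>C\<^esub> f \<boxtimes>\<^bsub>C\<^esub> Id C F)), whisker C [E] (prim_path C J (Bar f)) [F])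
      \<in> dual_rel_base C J"
| bar_Id: "A \<in> Ob C \<Longrightarrow>
    (prim_path C J (Bar (Id C A)), Id (dual_paths C J) [A]) \<in> dual_rel_base C J"
| bar_Comp: "f \<in> hom C A B \<Longrightarrow> g \<in> hom C B E \<Longrightarrow>
    (prim_path C J (Bar (g \<cdot>\<^bsub>C\<^esub> f)), prim_path C J (Bar g) \<cdot>\<^bsub>dual_paths C J\<^esub> prim_path C J (Bar f))
      \<in> dual_rel_base C J"
| exchange: "a \<in> arcs (dual_graph C J) \<Longrightarrow> b \<in> arcs (dual_graph C J) \<Longrightarrow>
    U = tail (dual_graph C J) a \<Longrightarrow> V = head (dual_graph C J) a \<Longrightarrow>
    W = tail (dual_graph C J) b \<Longrightarrow> X = head (dual_graph C J) b \<Longrightarrow>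
    (lwhisker C V (edge_path C J b) \<cdot>\<^bsub>dual_paths C J\<^esub> rwhisker C (edge_path C J a) W,
     rwhisker C (edge_path C J a) X \<cdot>\<^bsub>dual_paths C J\<^esub> lwhisker C U (edge_path C J b))
      \<in> dual_rel_base C J"
| triangle_J:
    "(rwhisker C (prim_path C J Eps) [J] \<cdot>\<^bsub>dual_paths C J\<^esub> lwhisker C [J] (prim_path C J Eta),
      Id (dual_paths C J) [J]) \<in> dual_rel_base C J"
| triangle_Jdual:
    "(lwhisker C (Jdual C) (prim_path C J Eps) \<cdot>\<^bsub>dual_paths C J\<^esub> rwhisker C (prim_path C J Eta) (Jdual C),
      Id (dual_paths C J) (Jdual C)) \<in> dual_rel_base C J"

definition dual_rel ::
    "('o, 'm, 'x) mon_cat_scheme \<Rightarrow> 'o \<Rightarrow> (('o list, ('o, 'm) edge) path \<times> ('o list, ('o, 'm) edge) path) set" where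
  "dual_rel C J = dual_rel_base C J \<union>
    {(whisker C Y p Z, whisker C Y q Z) | Y p q Z.
      Y \<in> obj_lists C \<and> Z \<in> obj_lists C \<and> (p, q) \<in> dual_rel_base C J}"

definition dual_cong ::
    "('o, 'm, 'x) mon_cat_scheme \<Rightarrow> 'o \<Rightarrow> (('o list, ('o, 'm) edge) path \<times> ('o list, ('o, 'm) edge) path) set" where
  "dual_cong C J = congruence_closure (dual_paths C J) (dual_rel C J)"

text \<open>A representative of \<open>[p] \<otimes> [q]\<close>: of the two sides of the exchange relation, the one that
  traverses \<open>p\<close> first.\<close>

definition path_tens ::
    "('o, 'm, 'x) mon_cat_scheme \<Rightarrow> 'o \<Rightarrow> ('o list, ('o, 'm) edge) path \<Rightarrow> ('o list, ('o, 'm) edge) path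
      \<Rightarrow> ('o list, ('o, 'm) edge) path" where
  "path_tens C J p q =
    lwhisker C (Cod (dual_paths C J) p) q \<cdot>\<^bsub>dual_paths C J\<^esub> rwhisker C p (Dom (dual_paths C J) q)"

definition adjoin_right_dual ::
    "('o, 'm, 'x) mon_cat_scheme \<Rightarrow> 'o \<Rightarrow> ('o list, ('o list, ('o, 'm) edge) path set) mon_cat" where
  "adjoin_right_dual C J =
    cat.extend (quotient_category (dual_paths C J) (dual_cong C J))
      (mon_cat.fields [\<I>\<^bsub>C\<^esub>] (ltens C) (class_op (dual_cong C J) (path_tens C J)))"

definition Omega_ob :: "'o \<Rightarrow> 'o list" where
  "Omega_ob A = [A]"

definition Omega_arr :: "('o, 'm, 'x) mon_cat_scheme \<Rightarrow> 'o \<Rightarrow> 'm \<Rightarrow> ('o list, ('o, 'm) edge) path set" where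
  "Omega_arr C J f = dual_cong C J `` {prim_path C J (Bar f)}"


section \<open>The construction is strict monoidal, and \<open>J\<close> acquires a right dual in it\<close>

lemma homI: "f \<in> Ar C \<Longrightarrow> Dom C f = A \<Longrightarrow> Cod C f = B \<Longrightarrow> f \<in> hom C A B"
  by (simp add: hom_def)

lemma homD:
  assumes "f \<in> hom C A B"
  shows "f \<in> Ar C" "Dom C f = A" "Cod C f = B"
  using assms by (simp_all add: hom_def)

lemma free_category_simps [simp]:
  "Ob (free_category G) = verts G"
  "(u, es, v) \<in> Ar (free_category G) \<longleftrightarrow> pre_digraph.awalk G u es v"
  "Dom (free_category G) (u, es, v) = u"
  "Cod (free_category G) (u, es, v) = v"
  "Id (free_category G) u = (u, [], u)"
  "(v', fs, w) \<cdot>\<^bsub>free_category G\<^esub> (u, es, v) = (u, es @ fs, w)"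
  by (simp_all add: free_category_def)

lemma category_free_category:
  assumes "wf_digraph G"
  shows "category (free_category G)"
proof -
  interpret wf_digraph G by fact
  show ?thesis
    by unfold_locales (auto simp: hom_def awalk_Nil_iff intro: awalk_hd_in_verts awalk_last_in_verts)
qed

lemma congruence_closure_parallel:
  assumes "category K"
    and R: "\<And>p q. (p, q) \<in> R \<Longrightarrow> p \<in> Ar K \<and> q \<in> Ar K \<and> Dom K p = Dom K q \<and> Cod K p = Cod K q"
    and "(p, q) \<in> congruence_closure K R"
  shows "p \<in> Ar K \<and> q \<in> Ar K \<and> Dom K p = Dom K q \<and> Cod K p = Cod K q"
  using assms(3)
proof induction
  case (comp p p' q q')
  interpret category K by fact
  have "q \<cdot>\<^bsub>K\<^esub> p \<in> hom K (Dom K p) (Cod K q)" "q' \<cdot>\<^bsub>K\<^esub> p' \<in> hom K (Dom K p) (Cod K q)"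
    using comp by (auto intro!: Comp_in homI)
  then show ?case by (auto simp: hom_def)
qed (use R in auto)

lemma equiv_congruence_closure:
  assumes "category K"
    and "\<And>p q. (p, q) \<in> R \<Longrightarrow> p \<in> Ar K \<and> q \<in> Ar K \<and> Dom K p = Dom K q \<and> Cod K p = Cod K q"
  shows "equiv (Ar K) (congruence_closure K R)"
  using congruence_closure_parallel[OF assms]
  by (intro equivI refl_onI symI transI)
    (auto intro: congruence_closure.refl congruence_closure.sym congruence_closure.trans)

lemma class_op_class:
  assumes "equiv A r" "x \<in> A" "y \<in> A"
    and "\<And>x' y'. (x, x') \<in> r \<Longrightarrow> (y, y') \<in> r \<Longrightarrow> (f x y, f x' y') \<in> r"
  shows "class_op r f (r `` {x}) (r `` {y}) = r `` {f x y}"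
proof -
  have "x \<in> r `` {x}" "y \<in> r `` {y}"
    using assms(1-3) equiv_class_self[of A r] by blast+
  moreover have "r `` {f x' y'} = r `` {f x y}" if "x' \<in> r `` {x}" "y' \<in> r `` {y}" for x' y'
    using equiv_class_eq[OF assms(1) assms(4)] that by auto
  ultimately show ?thesis
    unfolding class_op_def by blast
qed

locale category_congruence = category K
  for K :: "('o, 'm, 'x) cat_scheme" and r :: "('m \<times> 'm) set" +
  assumes equiv: "equiv (Ar K) r"
    and parallel: "(p, q) \<in> r \<Longrightarrow> Dom K p = Dom K q \<and> Cod K p = Cod K q"
    and comp_cong: "(p, p') \<in> r \<Longrightarrow> (q, q') \<in> r \<Longrightarrow> Cod K p = Dom K q \<Longrightarrow> (q \<cdot>\<^bsub>K\<^esub> p, q' \<cdot>\<^bsub>K\<^esub> p') \<in> r"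
begin

lemma class_self: "p \<in> Ar K \<Longrightarrow> p \<in> r `` {p}"
  using equiv by (rule equiv_class_self)

lemma quotient_Ob [simp]: "Ob (quotient_category K r) = Ob K"
  and quotient_Id [simp]: "Id (quotient_category K r) A = r `` {Id K A}"
  by (simp_all add: quotient_category_def)

lemma quotient_ArE:
  assumes "X \<in> Ar (quotient_category K r)"
  obtains p where "p \<in> Ar K" "X = r `` {p}"
  using assms by (auto simp: quotient_category_def elim: quotientE)

lemma quotient_Ar: "p \<in> Ar K \<Longrightarrow> r `` {p} \<in> Ar (quotient_category K r)"
  by (auto simp: quotient_category_def intro: quotientI)

lemma quotient_Dom: "p \<in> Ar K \<Longrightarrow> Dom (quotient_category K r) (r `` {p}) = Dom K p"
proof -
  assume p: "p \<in> Ar K"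
  have "Dom K q = Dom K p" if "q \<in> r `` {p}" for q
    using that parallel[of p q] by simp
  with class_self[OF p] have "Dom K ` (r `` {p}) = {Dom K p}"
    by blast
  then show ?thesis by (simp add: quotient_category_def)
qed

lemma quotient_Cod: "p \<in> Ar K \<Longrightarrow> Cod (quotient_category K r) (r `` {p}) = Cod K p"
proof -
  assume p: "p \<in> Ar K"
  have "Cod K q = Cod K p" if "q \<in> r `` {p}" for q
    using that parallel[of p q] by simp
  with class_self[OF p] have "Cod K ` (r `` {p}) = {Cod K p}"
    by blast
  then show ?thesis by (simp add: quotient_category_def)
qed

lemma quotient_homI: "p \<in> hom K A B \<Longrightarrow> r `` {p} \<in> hom (quotient_category K r) A B"
  by (simp add: hom_def quotient_Ar quotient_Dom quotient_Cod)

lemma quotient_homE: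
  assumes "X \<in> hom (quotient_category K r) A B"
  obtains p where "p \<in> hom K A B" "X = r `` {p}"
proof -
  have "X \<in> Ar (quotient_category K r)" using assms by (simp add: hom_def)
  then obtain p where p: "p \<in> Ar K" "X = r `` {p}" by (rule quotient_ArE)
  then have "p \<in> hom K A B"
    using assms quotient_Dom[OF p(1)] quotient_Cod[OF p(1)] by (simp add: hom_def)
  then show ?thesis using p(2) that by blast
qed

lemma quotient_Comp:
  assumes "p \<in> hom K A B" "q \<in> hom K B D"
  shows "r `` {q} \<cdot>\<^bsub>quotient_category K r\<^esub> r `` {p} = r `` {q \<cdot>\<^bsub>K\<^esub> p}"
  using assms class_op_class[OF equiv, of q p "Comp K"] comp_cong
  by (auto simp: quotient_category_def hom_def)

lemma category_quotient: "category (quotient_category K r)"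
proof
  fix X A B assume "X \<in> hom (quotient_category K r) A B"
  then obtain p where p: "p \<in> hom K A B" "X = r `` {p}" by (rule quotient_homE)
  have AB: "A \<in> Ob K" "B \<in> Ob K"
    using p Dom_in Cod_in by (auto simp: hom_def)
  show "X \<cdot>\<^bsub>quotient_category K r\<^esub> Id (quotient_category K r) A = X"
    using quotient_Comp[OF Id_in[OF AB(1)] p(1)] p Id_right by simp
  show "Id (quotient_category K r) B \<cdot>\<^bsub>quotient_category K r\<^esub> X = X"
    using quotient_Comp[OF p(1) Id_in[OF AB(2)]] p Id_left by simp
  fix Y D assume "Y \<in> hom (quotient_category K r) B D"
  then obtain q where q: "q \<in> hom K B D" "Y = r `` {q}" by (rule quotient_homE)
  show "Y \<cdot>\<^bsub>quotient_category K r\<^esub> X \<in> hom (quotient_category K r) A D"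
    using quotient_Comp[OF p(1) q(1)] p q quotient_homI[OF Comp_in] by simp
  fix Z E assume "Z \<in> hom (quotient_category K r) D E"
  then obtain s where s: "s \<in> hom K D E" "Z = r `` {s}" by (rule quotient_homE)
  show "Z \<cdot>\<^bsub>quotient_category K r\<^esub> Y \<cdot>\<^bsub>quotient_category K r\<^esub> X =
      Z \<cdot>\<^bsub>quotient_category K r\<^esub> (Y \<cdot>\<^bsub>quotient_category K r\<^esub> X)"
    using p q s Comp_in Comp_assoc[OF p(1) q(1) s(1)]
      quotient_Comp[OF p(1) q(1)] quotient_Comp[OF q(1) s(1)]
      quotient_Comp[OF p(1) Comp_in[OF q(1) s(1)]] quotient_Comp[OF Comp_in[OF p(1) q(1)] s(1)]
    by simp
next
  fix A assume "A \<in> Ob (quotient_category K r)"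
  then show "Id (quotient_category K r) A \<in> hom (quotient_category K r) A A"
    by (simp add: quotient_homI Id_in)
next
  fix X assume "X \<in> Ar (quotient_category K r)"
  then show "Dom (quotient_category K r) X \<in> Ob (quotient_category K r)"
    "Cod (quotient_category K r) X \<in> Ob (quotient_category K r)"
    by (auto simp: quotient_Dom quotient_Cod Dom_in Cod_in elim!: quotient_ArE)
qed

end

locale adjoin_dual = strict_monoidal_category C
  for C :: "('o, 'm, 'x) mon_cat_scheme" (structure) and J :: 'o +
  assumes J_in: "J \<in> Ob C"
begin

abbreviation "G \<equiv> dual_graph C J"
abbreviation "P \<equiv> dual_paths C J"
abbreviation "r \<equiv> dual_cong C J"
abbreviation "Q \<equiv> adjoin_right_dual C J"
abbreviation "L \<equiv> obj_lists C"

lemma singleton_L [simp]: "[A] \<in> L \<longleftrightarrow> A \<in> Ob C"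
  by (simp add: obj_lists_def)

lemma Jdual_L [simp]: "Jdual C \<in> L"
  by (simp add: obj_lists_def Jdual_def Unit_in)

declare Unit_in [simp]

lemma L_snocE:
  assumes "U \<in> L"
  obtains us u where "U = us @ [u]" "set us \<subseteq> Ob C" "u \<in> Ob C"
  using assms by (cases U rule: rev_cases) (auto simp: obj_lists_def)

lemma L_consE:
  assumes "U \<in> L"
  obtains us u where "U = u # us" "set us \<subseteq> Ob C" "u \<in> Ob C"
  using assms by (cases U) (auto simp: obj_lists_def)

lemma ltens_L [simp]: "U \<in> L \<Longrightarrow> V \<in> L \<Longrightarrow> U \<odot> V \<in> L"
  by (elim L_consE[of V] L_snocE[of U]) (auto simp: obj_lists_def ltens_def TensO_in)

lemma ltens_unit_left [simp]: "U \<in> L \<Longrightarrow> [\<I>] \<odot> U = U"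
  by (elim L_consE) (auto simp: ltens_def TensO_unit_left)

lemma ltens_unit_right [simp]: "U \<in> L \<Longrightarrow> U \<odot> [\<I>] = U"
  by (elim L_snocE) (auto simp: ltens_def TensO_unit_right)

lemma ltens_assoc: "U \<in> L \<Longrightarrow> V \<in> L \<Longrightarrow> W \<in> L \<Longrightarrow> U \<odot> V \<odot> W = U \<odot> (V \<odot> W)"
proof -
  assume U: "U \<in> L" and V: "V \<in> L" and W: "W \<in> L"
  obtain us u where u: "U = us @ [u]" "u \<in> Ob C" using U by (rule L_snocE)
  obtain ws w where w: "W = w # ws" "w \<in> Ob C" using W by (rule L_consE)
  obtain vs v where v: "V = v # vs" "v \<in> Ob C" using V by (rule L_consE)
  show ?thesis
  proof (cases vs rule: rev_cases)
    case Nil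
    then show ?thesis using u v w by (simp add: ltens_def TensO_assoc)
  next
    case (snoc vs' v')
    then show ?thesis using u v w by (simp add: ltens_def butlast_append)
  qed
qed

lemma verts_G [simp]: "verts G = L"
  by (simp add: dual_graph_def)

lemma prim_dom_L [simp]: "p \<in> prims C \<Longrightarrow> prim_dom C J p \<in> L"
  by (auto simp: prims_def J_in Dom_in)

lemma prim_cod_L [simp]: "p \<in> prims C \<Longrightarrow> prim_cod C J p \<in> L"
  by (auto simp: prims_def J_in Cod_in)

lemma arcs_G [simp]: "(U, p, V) \<in> arcs G \<longleftrightarrow> U \<in> L \<and> p \<in> prims C \<and> V \<in> L"
  by (simp add: dual_graph_def)

lemma tail_G [simp]: "tail G (U, p, V) = U \<odot> prim_dom C J p \<odot> V"
  and head_G [simp]: "head G (U, p, V) = U \<odot> prim_cod C J p \<odot> V"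
  by (simp_all add: dual_graph_def)

sublocale G: wf_digraph G
  by unfold_locales auto

sublocale P: category P
  by (rule category_free_category) (rule G.wf_digraph_axioms)

lemma whisker_edge_arcs [simp]: "a \<in> arcs G \<Longrightarrow> T \<in> L \<Longrightarrow> W \<in> L \<Longrightarrow> whisker_edge C T a W \<in> arcs G"
  and tail_whisker_edge [simp]: "a \<in> arcs G \<Longrightarrow> T \<in> L \<Longrightarrow> W \<in> L \<Longrightarrow>
    tail G (whisker_edge C T a W) = T \<odot> tail G a \<odot> W"
  and head_whisker_edge [simp]: "a \<in> arcs G \<Longrightarrow> T \<in> L \<Longrightarrow> W \<in> L \<Longrightarrow>
    head G (whisker_edge C T a W) = T \<odot> head G a \<odot> W"
  by (cases a; auto simp: whisker_edge_def ltens_assoc)+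

lemma cas_whisker:
  "T \<in> L \<Longrightarrow> W \<in> L \<Longrightarrow> set es \<subseteq> arcs G \<Longrightarrow> G.cas u es v \<Longrightarrow>
    G.cas (T \<odot> u \<odot> W) (map (\<lambda>a. whisker_edge C T a W) es) (T \<odot> v \<odot> W)"
  by (induction es arbitrary: u) auto

lemma P_hom_iff: "(u, es, v) \<in> hom P A B \<longleftrightarrow> G.awalk u es v \<and> u = A \<and> v = B"
  by (simp add: hom_def)

lemma P_homE:
  assumes "p \<in> hom P A B"
  obtains es where "p = (A, es, B)" "G.awalk A es B" "A \<in> L" "B \<in> L" "set es \<subseteq> arcs G"
proof -
  obtain es where "p = (A, es, B)" "G.awalk A es B"
    using assms by (cases p) (auto simp: P_hom_iff)
  then show ?thesis
    using that G.awalk_hd_in_verts[of A es B] G.awalk_last_in_verts[of A es B]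
    by (auto simp: G.awalk_def)
qed

lemma P_hom_L: "p \<in> hom P A B \<Longrightarrow> A \<in> L" "p \<in> hom P A B \<Longrightarrow> B \<in> L"
  by (auto elim: P_homE)

lemma whisker_hom:
  "p \<in> hom P A B \<Longrightarrow> T \<in> L \<Longrightarrow> W \<in> L \<Longrightarrow> whisker C T p W \<in> hom P (T \<odot> A \<odot> W) (T \<odot> B \<odot> W)"
  by (erule P_homE) (auto simp: whisker_def P_hom_iff G.awalk_def intro!: cas_whisker)

lemma lwhisker_hom:
  "p \<in> hom P A B \<Longrightarrow> T \<in> L \<Longrightarrow> lwhisker C T p \<in> hom P (T \<odot> A) (T \<odot> B)"
  using whisker_hom[of p A B T "[\<I>]"] P_hom_L[of p A B] by simp

lemma rwhisker_hom:
  "p \<in> hom P A B \<Longrightarrow> W \<in> L \<Longrightarrow> rwhisker C p W \<in> hom P (A \<odot> W) (B \<odot> W)"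
  using whisker_hom[of p A B "[\<I>]" W] P_hom_L[of p A B] by simp

lemma edge_path_hom: "a \<in> arcs G \<Longrightarrow> edge_path C J a \<in> hom P (tail G a) (head G a)"
  by (simp add: edge_path_def P_hom_iff G.arc_implies_awalk)

lemma prim_path_hom: "p \<in> prims C \<Longrightarrow> prim_path C J p \<in> hom P (prim_dom C J p) (prim_cod C J p)"
  using edge_path_hom[of "prim_edge C p"] by (simp add: prim_edge_def)

lemma prims [simp]: "Eps \<in> prims C" "Eta \<in> prims C" "Bar f \<in> prims C \<longleftrightarrow> f \<in> Ar C"
  by (auto simp: prims_def)

lemma Eps_hom: "prim_path C J Eps \<in> hom P ([J] \<odot> Jdual C) [\<I>]"
  and Eta_hom: "prim_path C J Eta \<in> hom P [\<I>] (Jdual C \<odot> [J])"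
  and Bar_hom: "f \<in> hom C A B \<Longrightarrow> prim_path C J (Bar f) \<in> hom P [A] [B]"
  using prim_path_hom[of Eps] prim_path_hom[of Eta] prim_path_hom[of "Bar f"]
  by (auto simp: hom_def)

lemma whisker_whisker:
  assumes "p \<in> hom P A B" "T \<in> L" "W \<in> L" "T' \<in> L" "W' \<in> L"
  shows "whisker C T' (whisker C T p W) W' = whisker C (T' \<odot> T) p (W \<odot> W')"
proof -
  obtain es where es: "p = (A, es, B)" "set es \<subseteq> arcs G" "A \<in> L" "B \<in> L"
    using assms(1) by (rule P_homE)
  have "whisker_edge C T' (whisker_edge C T a W) W' = whisker_edge C (T' \<odot> T) a (W \<odot> W')"
    if "a \<in> arcs G" for a
    using that assms by (cases a) (auto simp: whisker_edge_def ltens_assoc)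
  then show ?thesis
    using es assms by (auto simp: whisker_def ltens_assoc)
qed

lemma whisker_unit: "p \<in> hom P A B \<Longrightarrow> whisker C [\<I>] p [\<I>] = p"
proof (erule P_homE)
  fix es assume es: "p = (A, es, B)" "set es \<subseteq> arcs G" "A \<in> L" "B \<in> L"
  have "whisker_edge C [\<I>] a [\<I>] = a" if "a \<in> arcs G" for a
    using that by (cases a) (auto simp: whisker_edge_def)
  then have "map (\<lambda>a. whisker_edge C [\<I>] a [\<I>]) es = es"
    using es(2) by (intro map_idI) auto
  then show ?thesis
    using es by (simp add: whisker_def)
qed

lemma whisker_Comp:
  "p \<in> hom P A B \<Longrightarrow> q \<in> hom P B D \<Longrightarrow>
    whisker C T (q \<cdot>\<^bsub>P\<^esub> p) W = whisker C T q W \<cdot>\<^bsub>P\<^esub> whisker C T p W"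
  by (elim P_homE) (simp add: whisker_def)

lemma whisker_Id: "whisker C T (Id P A) W = Id P (T \<odot> A \<odot> W)"
  by (simp add: whisker_def)

lemma Jdual_tens: "[J] \<odot> Jdual C \<odot> [J] = [J] \<odot> (Jdual C \<odot> [J])"
  "Jdual C \<odot> [J] \<odot> Jdual C = Jdual C \<odot> ([J] \<odot> Jdual C)"
  by (simp_all add: ltens_assoc J_in)

lemma triangle_J_homs:
  "lwhisker C [J] (prim_path C J Eta) \<in> hom P [J] ([J] \<odot> (Jdual C \<odot> [J]))"
  "rwhisker C (prim_path C J Eps) [J] \<in> hom P ([J] \<odot> (Jdual C \<odot> [J])) [J]"
  "lwhisker C (Jdual C) (prim_path C J Eps) \<in> hom P (Jdual C \<odot> [J] \<odot> Jdual C) (Jdual C)"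
  "rwhisker C (prim_path C J Eta) (Jdual C) \<in> hom P (Jdual C) (Jdual C \<odot> [J] \<odot> Jdual C)"
  using lwhisker_hom[OF Eta_hom, of "[J]"] rwhisker_hom[OF Eps_hom, of "[J]"]
    lwhisker_hom[OF Eps_hom, of "Jdual C"] rwhisker_hom[OF Eta_hom, of "Jdual C"]
  by (simp_all add: J_in Jdual_tens)

lemma dual_rel_base_parallel:
  assumes "(p, q) \<in> dual_rel_base C J"
  shows "\<exists>A B. p \<in> hom P A B \<and> q \<in> hom P A B"
  using assms
proof cases
  case (bar_whisker E F f)
  have f: "f \<in> hom C (Dom C f) (Cod C f)" using bar_whisker by (simp add: hom_def)
  have "Id C E \<boxtimes> f \<boxtimes> Id C F \<in> hom C (E \<otimes> Dom C f \<otimes> F) (E \<otimes> Cod C f \<otimes> F)"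
    using bar_whisker f by (intro TensA_in Id_in) auto
  then show ?thesis
    using whisker_hom[OF Bar_hom[OF f], of "[E]" "[F]"] Bar_hom bar_whisker
    by (fastforce simp: ltens_def)
next
  case (bar_Id A)
  then show ?thesis using Bar_hom[OF Id_in] P.Id_in[of "[A]"] by auto
next
  case (bar_Comp f A B g E)
  then show ?thesis using Bar_hom[OF Comp_in] P.Comp_in[OF Bar_hom Bar_hom] by blast
next
  case (exchange a b U V W X)
  then show ?thesis
    using P.Comp_in[OF rwhisker_hom[OF edge_path_hom[of a], of "tail G b"]
        lwhisker_hom[OF edge_path_hom[of b], of "head G a"]]
      P.Comp_in[OF lwhisker_hom[OF edge_path_hom[of b], of "tail G a"]
        rwhisker_hom[OF edge_path_hom[of a], of "head G b"]]
      G.tail_in_verts[of a] G.tail_in_verts[of b] G.head_in_verts[of a] G.head_in_verts[of b]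
    by (auto simp del: G.tail_in_verts G.head_in_verts)
next
  case triangle_J
  then show ?thesis
    using P.Comp_in[OF triangle_J_homs(1,2)] P.Id_in[of "[J]"] by (auto simp: J_in)
next
  case triangle_Jdual
  then show ?thesis
    using P.Comp_in[OF triangle_J_homs(4,3)] P.Id_in[of "Jdual C"] by auto
qed

lemma dual_relI:
  assumes "(p, q) \<in> dual_rel_base C J"
  shows "(p, q) \<in> dual_rel C J" "Y \<in> L \<Longrightarrow> Z \<in> L \<Longrightarrow> (whisker C Y p Z, whisker C Y q Z) \<in> dual_rel C J"
  using assms unfolding dual_rel_def by blast+

lemma dual_relE:
  assumes "(p, q) \<in> dual_rel C J"
  obtains Y p' q' Z where "Y \<in> L" "Z \<in> L" "(p', q') \<in> dual_rel_base C J"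
    "p = whisker C Y p' Z" "q = whisker C Y q' Z"
proof -
  from assms consider "(p, q) \<in> dual_rel_base C J" |
    Y Z p' q' where "Y \<in> L" "Z \<in> L" "(p', q') \<in> dual_rel_base C J"
      "p = whisker C Y p' Z" "q = whisker C Y q' Z"
    by (auto simp: dual_rel_def)
  then show ?thesis
  proof cases
    case 1
    then obtain A B where "p \<in> hom P A B" "q \<in> hom P A B" using dual_rel_base_parallel by blast
    then show ?thesis using 1 that[of "[\<I>]" "[\<I>]" p q] by (simp add: whisker_unit)
  qed (rule that)
qed

lemma dual_rel_parallel:
  assumes "(p, q) \<in> dual_rel C J"
  shows "p \<in> Ar P \<and> q \<in> Ar P \<and> Dom P p = Dom P q \<and> Cod P p = Cod P q"
  using assms
proof (rule dual_relE)
  fix Y p' q' Z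
  assume *: "Y \<in> L" "Z \<in> L" "(p', q') \<in> dual_rel_base C J"
    "p = whisker C Y p' Z" "q = whisker C Y q' Z"
  then obtain A B where "p' \<in> hom P A B" "q' \<in> hom P A B" using dual_rel_base_parallel by blast
  then have "p \<in> hom P (Y \<odot> A \<odot> Z) (Y \<odot> B \<odot> Z)" "q \<in> hom P (Y \<odot> A \<odot> Z) (Y \<odot> B \<odot> Z)"
    using * by (auto intro: whisker_hom)
  then show ?thesis by (simp add: hom_def)
qed

sublocale PC: category_congruence P r
proof
  show "equiv (Ar P) r"
    unfolding dual_cong_def
    by (rule equiv_congruence_closure[OF P.category_axioms dual_rel_parallel])
  show "Dom P p = Dom P q \<and> Cod P p = Cod P q" if "(p, q) \<in> r" for p q
    using congruence_closure_parallel[OF P.category_axioms dual_rel_parallel] that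
    unfolding dual_cong_def by blast
  show "(q \<cdot>\<^bsub>P\<^esub> p, q' \<cdot>\<^bsub>P\<^esub> p') \<in> r" if "(p, p') \<in> r" "(q, q') \<in> r" "Cod P p = Dom P q" for p q p' q'
    using that unfolding dual_cong_def by (rule congruence_closure.comp)
qed

lemma cong_hom:
  assumes "(p, q) \<in> r"
  shows "p \<in> hom P (Dom P p) (Cod P p)" "q \<in> hom P (Dom P p) (Cod P p)"
  using assms PC.equiv PC.parallel[OF assms]
  by (auto simp: hom_def equiv_def refl_on_def)

lemma cong_refl: "p \<in> hom P A B \<Longrightarrow> (p, p) \<in> r"
  using congruence_closure.refl[of p P] by (simp add: hom_def dual_cong_def)

lemma cong_sym: "(p, q) \<in> r \<Longrightarrow> (q, p) \<in> r"
  unfolding dual_cong_def by (rule congruence_closure.sym)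

lemma cong_trans [trans]: "(p, q) \<in> r \<Longrightarrow> (q, s) \<in> r \<Longrightarrow> (p, s) \<in> r"
  unfolding dual_cong_def by (rule congruence_closure.trans)

lemma cong_eq_trans [trans]: "(p, q) \<in> r \<Longrightarrow> q = s \<Longrightarrow> (p, s) \<in> r"
  and eq_cong_trans [trans]: "p = q \<Longrightarrow> (q, s) \<in> r \<Longrightarrow> (p, s) \<in> r"
  by simp_all

lemma cong_base: "(p, q) \<in> dual_rel_base C J \<Longrightarrow> (p, q) \<in> r"
  unfolding dual_cong_def by (intro congruence_closure.incl dual_relI)

lemma cong_whisker:
  assumes "(p, q) \<in> r" "Y \<in> L" "Z \<in> L"
  shows "(whisker C Y p Z, whisker C Y q Z) \<in> r"
  using assms(1) unfolding dual_cong_def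
proof induction
  case (incl p q)
  then obtain Y' Z' p' q' where *: "Y' \<in> L" "Z' \<in> L" "(p', q') \<in> dual_rel_base C J"
    "p = whisker C Y' p' Z'" "q = whisker C Y' q' Z'" by (rule dual_relE)
  obtain A B where "p' \<in> hom P A B" "q' \<in> hom P A B" using dual_rel_base_parallel * by blast
  then have "(whisker C Y p Z, whisker C Y q Z) =
      (whisker C (Y \<odot> Y') p' (Z' \<odot> Z), whisker C (Y \<odot> Y') q' (Z' \<odot> Z))"
    using * assms by (simp add: whisker_whisker)
  also have "\<dots> \<in> dual_rel C J"
    using * assms by (intro dual_relI) auto
  finally show ?case by (rule congruence_closure.incl)
next
  case (refl p)
  then have "whisker C Y p Z \<in> Ar P"
    using whisker_hom[OF _ assms(2,3), of p] by (auto simp: hom_def)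
  then show ?case by (rule congruence_closure.refl)
next
  case (sym p q) then show ?case by (blast intro: congruence_closure.sym)
next
  case (trans p q s) then show ?case by (blast intro: congruence_closure.trans)
next
  case (comp p p' q q')
  have p: "p \<in> hom P (Dom P p) (Cod P p)" "p' \<in> hom P (Dom P p) (Cod P p)"
    using comp cong_hom[of p p'] by (auto simp: dual_cong_def)
  have q: "q \<in> hom P (Cod P p) (Cod P q)" "q' \<in> hom P (Cod P p) (Cod P q)"
    using comp cong_hom[of q q'] by (auto simp: dual_cong_def)
  have "Cod P (whisker C Y p Z) = Dom P (whisker C Y q Z)"
    using whisker_hom[OF p(1) assms(2,3)] whisker_hom[OF q(1) assms(2,3)] by (simp add: hom_def)
  then show ?case
    using congruence_closure.comp[OF comp.IH] whisker_Comp[OF p(1) q(1)] whisker_Comp[OF p(2) q(2)]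
    by simp
qed

lemma path_tens_eq: "p \<in> hom P U V \<Longrightarrow> q \<in> hom P W X \<Longrightarrow>
    path_tens C J p q = lwhisker C V q \<cdot>\<^bsub>P\<^esub> rwhisker C p W"
  by (simp add: path_tens_def hom_def)

lemma path_tens_hom:
  assumes "p \<in> hom P U V" "q \<in> hom P W X"
  shows "path_tens C J p q \<in> hom P (U \<odot> W) (V \<odot> X)"
  using path_tens_eq[OF assms] P.Comp_in[OF rwhisker_hom[OF assms(1)] lwhisker_hom[OF assms(2)]]
    P_hom_L[OF assms(1)] P_hom_L[OF assms(2)] by simp

lemma comp_cong_hom:
  "(p, p') \<in> r \<Longrightarrow> (q, q') \<in> r \<Longrightarrow> p \<in> hom P A B \<Longrightarrow> q \<in> hom P B D \<Longrightarrow>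
    (q \<cdot>\<^bsub>P\<^esub> p, q' \<cdot>\<^bsub>P\<^esub> p') \<in> r"
  by (rule PC.comp_cong) (simp_all add: hom_def)

lemma path_split:
  assumes "(u, a # es, v) \<in> hom P u v"
  shows "(u, a # es, v) = (head G a, es, v) \<cdot>\<^bsub>P\<^esub> edge_path C J a"
    "a \<in> arcs G" "tail G a = u" "(head G a, es, v) \<in> hom P (head G a) v"
    "edge_path C J a \<in> hom P u (head G a)"
  using assms edge_path_hom[of a]
  by (auto simp: P_hom_iff G.awalk_Cons_iff edge_path_def)

lemma exchange_edge_path:
  assumes "a \<in> arcs G" "q \<in> hom P W X"
  shows "(lwhisker C (head G a) q \<cdot>\<^bsub>P\<^esub> rwhisker C (edge_path C J a) W,
     rwhisker C (edge_path C J a) X \<cdot>\<^bsub>P\<^esub> lwhisker C (tail G a) q) \<in> r"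
proof -
  define A where "A = edge_path C J a"
  have A: "A \<in> hom P (tail G a) (head G a)" using edge_path_hom[OF assms(1)] by (simp add: A_def)
  obtain es where "q = (W, es, X)" using assms(2) by (rule P_homE)
  then have "(W, es, X) \<in> hom P W X" using assms by simp
  then have "(lwhisker C (head G a) (W, es, X) \<cdot>\<^bsub>P\<^esub> rwhisker C A W,
     rwhisker C A X \<cdot>\<^bsub>P\<^esub> lwhisker C (tail G a) (W, es, X)) \<in> r"
  proof (induction es arbitrary: W)
    case Nil
    then have "W = X" "X \<in> L" by (auto simp: P_hom_iff G.awalk_Nil_iff)
    then have N: "(W, [], X) = Id P X" by simp
    have "rwhisker C A X \<in> hom P (tail G a \<odot> X) (head G a \<odot> X)"
      using A \<open>X \<in> L\<close> by (rule rwhisker_hom)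
    then show ?case
      unfolding N whisker_Id using P_hom_L[OF A] \<open>X \<in> L\<close> \<open>W = X\<close>
        P.Id_left[of "rwhisker C A X"] P.Id_right[of "rwhisker C A X"] cong_refl
      by (simp del: free_category_simps)
  next
    case (Cons b es)
    note s = path_split[OF Cons.prems]
    let ?B = "edge_path C J b" and ?q = "(head G b, es, X)"
    let ?U = "tail G a" and ?V = "head G a" and ?M = "head G b"
    have L: "?U \<in> L" "?V \<in> L" "W \<in> L" "?M \<in> L" "X \<in> L"
      using P_hom_L[OF A] P_hom_L[OF s(4)] P_hom_L[OF s(5)] by auto
    note h = rwhisker_hom[OF A L(3)] rwhisker_hom[OF A L(4)] rwhisker_hom[OF A L(5)]
      lwhisker_hom[OF s(5) L(1)] lwhisker_hom[OF s(5) L(2)]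
      lwhisker_hom[OF s(4) L(1)] lwhisker_hom[OF s(4) L(2)]
    have "lwhisker C ?V (W, b # es, X) \<cdot>\<^bsub>P\<^esub> rwhisker C A W
        = lwhisker C ?V ?q \<cdot>\<^bsub>P\<^esub> (lwhisker C ?V ?B \<cdot>\<^bsub>P\<^esub> rwhisker C A W)"
      unfolding s(1) whisker_Comp[OF s(5,4)] by (rule P.Comp_assoc[OF h(1) h(5) h(7)])
    also have "(\<dots>, lwhisker C ?V ?q \<cdot>\<^bsub>P\<^esub> (rwhisker C A ?M \<cdot>\<^bsub>P\<^esub> lwhisker C ?U ?B)) \<in> r"
      using dual_rel_base.exchange[OF assms(1) s(2) HOL.refl HOL.refl HOL.refl HOL.refl] s(3)
      by (intro comp_cong_hom[OF _ cong_refl[OF h(7)] P.Comp_in[OF h(1) h(5)] h(7)] cong_base)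
        (simp add: A_def)
    also have "lwhisker C ?V ?q \<cdot>\<^bsub>P\<^esub> (rwhisker C A ?M \<cdot>\<^bsub>P\<^esub> lwhisker C ?U ?B)
        = lwhisker C ?V ?q \<cdot>\<^bsub>P\<^esub> rwhisker C A ?M \<cdot>\<^bsub>P\<^esub> lwhisker C ?U ?B"
      by (rule P.Comp_assoc[OF h(4) h(2) h(7), symmetric])
    also have "(\<dots>, rwhisker C A X \<cdot>\<^bsub>P\<^esub> lwhisker C ?U ?q \<cdot>\<^bsub>P\<^esub> lwhisker C ?U ?B) \<in> r"
      by (rule comp_cong_hom[OF cong_refl[OF h(4)] Cons.IH[OF s(4)] h(4) P.Comp_in[OF h(2) h(7)]])
    also have "rwhisker C A X \<cdot>\<^bsub>P\<^esub> lwhisker C ?U ?q \<cdot>\<^bsub>P\<^esub> lwhisker C ?U ?B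
        = rwhisker C A X \<cdot>\<^bsub>P\<^esub> lwhisker C ?U (W, b # es, X)"
      unfolding s(1) whisker_Comp[OF s(5,4)] by (rule P.Comp_assoc[OF h(4) h(6) h(3)])
    finally show ?case .
  qed
  then show ?thesis using \<open>q = _\<close> A_def by simp
qed

lemma exchange_path:
  assumes "p \<in> hom P U V" and q: "q \<in> hom P W X"
  shows "(lwhisker C V q \<cdot>\<^bsub>P\<^esub> rwhisker C p W, rwhisker C p X \<cdot>\<^bsub>P\<^esub> lwhisker C U q) \<in> r"
proof -
  obtain es where "p = (U, es, V)" using assms(1) by (rule P_homE)
  then have "(U, es, V) \<in> hom P U V" using assms by simp
  then have "(lwhisker C V q \<cdot>\<^bsub>P\<^esub> rwhisker C (U, es, V) W,
     rwhisker C (U, es, V) X \<cdot>\<^bsub>P\<^esub> lwhisker C U q) \<in> r"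
  proof (induction es arbitrary: U)
    case Nil
    then have "U = V" "V \<in> L" by (auto simp: P_hom_iff G.awalk_Nil_iff)
    then have N: "(U, [], V) = Id P V" by simp
    have "lwhisker C V q \<in> hom P (V \<odot> W) (V \<odot> X)"
      using q \<open>V \<in> L\<close> by (rule lwhisker_hom)
    then show ?case
      unfolding N whisker_Id using P_hom_L[OF q] \<open>V \<in> L\<close> \<open>U = V\<close>
        P.Id_left[of "lwhisker C V q"] P.Id_right[of "lwhisker C V q"] cong_refl
      by (simp del: free_category_simps)
  next
    case (Cons a es)
    note s = path_split[OF Cons.prems]
    let ?A = "edge_path C J a" and ?p = "(head G a, es, V)" and ?M = "head G a"
    have L: "U \<in> L" "V \<in> L" "W \<in> L" "?M \<in> L" "X \<in> L"
      using P_hom_L[OF q] P_hom_L[OF s(4)] P_hom_L[OF s(5)] by auto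
    note h = rwhisker_hom[OF s(5) L(3)] rwhisker_hom[OF s(5) L(5)] rwhisker_hom[OF s(4) L(3)]
      rwhisker_hom[OF s(4) L(5)] lwhisker_hom[OF q L(1)] lwhisker_hom[OF q L(2)] lwhisker_hom[OF q L(4)]
    have "lwhisker C V q \<cdot>\<^bsub>P\<^esub> rwhisker C (U, a # es, V) W
        = lwhisker C V q \<cdot>\<^bsub>P\<^esub> rwhisker C ?p W \<cdot>\<^bsub>P\<^esub> rwhisker C ?A W"
      unfolding s(1) whisker_Comp[OF s(5,4)] by (rule P.Comp_assoc[OF h(1) h(3) h(6), symmetric])
    also have "(\<dots>, rwhisker C ?p X \<cdot>\<^bsub>P\<^esub> lwhisker C ?M q \<cdot>\<^bsub>P\<^esub> rwhisker C ?A W) \<in> r"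
      by (rule comp_cong_hom[OF cong_refl[OF h(1)] Cons.IH[OF s(4)] h(1) P.Comp_in[OF h(3) h(6)]])
    also have "rwhisker C ?p X \<cdot>\<^bsub>P\<^esub> lwhisker C ?M q \<cdot>\<^bsub>P\<^esub> rwhisker C ?A W
        = rwhisker C ?p X \<cdot>\<^bsub>P\<^esub> (lwhisker C ?M q \<cdot>\<^bsub>P\<^esub> rwhisker C ?A W)"
      by (rule P.Comp_assoc[OF h(1) h(7) h(4)])
    also have "(\<dots>, rwhisker C ?p X \<cdot>\<^bsub>P\<^esub> (rwhisker C ?A X \<cdot>\<^bsub>P\<^esub> lwhisker C U q)) \<in> r"
      using exchange_edge_path[OF s(2) q] s(3)
      by (intro comp_cong_hom[OF _ cong_refl[OF h(4)] P.Comp_in[OF h(1) h(7)] h(4)]) simp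
    also have "rwhisker C ?p X \<cdot>\<^bsub>P\<^esub> (rwhisker C ?A X \<cdot>\<^bsub>P\<^esub> lwhisker C U q)
        = rwhisker C (U, a # es, V) X \<cdot>\<^bsub>P\<^esub> lwhisker C U q"
      unfolding s(1) whisker_Comp[OF s(5,4)] by (rule P.Comp_assoc[OF h(5) h(2) h(4), symmetric])
    finally show ?case .
  qed
  then show ?thesis using \<open>p = _\<close> by simp
qed

lemma cong_path_tens:
  assumes "(p, p') \<in> r" "(q, q') \<in> r"
  shows "(path_tens C J p q, path_tens C J p' q') \<in> r"
proof -
  let ?U = "Dom P p" and ?V = "Cod P p" and ?W = "Dom P q" and ?X = "Cod P q"
  note p = cong_hom[OF assms(1)] and q = cong_hom[OF assms(2)]
  show ?thesis
    unfolding path_tens_eq[OF p(1) q(1)] path_tens_eq[OF p(2) q(2)]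
    using P_hom_L[OF p(1)] P_hom_L[OF q(1)] assms
    by (intro comp_cong_hom[OF _ _ rwhisker_hom[OF p(1)] lwhisker_hom[OF q(1)]] cong_whisker) auto
qed

lemma path_tens_Comp:
  assumes p: "p \<in> hom P U V" and q: "q \<in> hom P V W" and p': "p' \<in> hom P U' V'" and q': "q' \<in> hom P V' W'"
  shows "(path_tens C J (q \<cdot>\<^bsub>P\<^esub> p) (q' \<cdot>\<^bsub>P\<^esub> p'), path_tens C J q q' \<cdot>\<^bsub>P\<^esub> path_tens C J p p') \<in> r"
proof -
  have L: "U \<in> L" "V \<in> L" "W \<in> L" "U' \<in> L" "V' \<in> L" "W' \<in> L"
    using assms by (blast intro: P_hom_L)+
  note h = rwhisker_hom[OF p L(4)] rwhisker_hom[OF q L(4)] lwhisker_hom[OF p' L(3)]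
    lwhisker_hom[OF q' L(3)] rwhisker_hom[OF q L(5)] lwhisker_hom[OF p' L(2)]
  have "path_tens C J (q \<cdot>\<^bsub>P\<^esub> p) (q' \<cdot>\<^bsub>P\<^esub> p')
      = (lwhisker C W q' \<cdot>\<^bsub>P\<^esub> lwhisker C W p') \<cdot>\<^bsub>P\<^esub> (rwhisker C q U' \<cdot>\<^bsub>P\<^esub> rwhisker C p U')"
    using path_tens_eq[OF P.Comp_in[OF p q] P.Comp_in[OF p' q']]
    by (simp only: whisker_Comp[OF p q] whisker_Comp[OF p' q'])
  also have "\<dots> = lwhisker C W q' \<cdot>\<^bsub>P\<^esub> ((lwhisker C W p' \<cdot>\<^bsub>P\<^esub> rwhisker C q U') \<cdot>\<^bsub>P\<^esub> rwhisker C p U')"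
    using P.Comp_assoc[OF h(1,2,3)] P.Comp_assoc[OF P.Comp_in[OF h(1,2)] h(3,4)] by simp
  also have "(\<dots>, lwhisker C W q' \<cdot>\<^bsub>P\<^esub> ((rwhisker C q V' \<cdot>\<^bsub>P\<^esub> lwhisker C V p') \<cdot>\<^bsub>P\<^esub> rwhisker C p U')) \<in> r"
    by (rule comp_cong_hom[OF comp_cong_hom[OF cong_refl[OF h(1)] exchange_path[OF q p'] h(1)
        P.Comp_in[OF h(2,3)]] cong_refl[OF h(4)] P.Comp_in[OF h(1) P.Comp_in[OF h(2,3)]] h(4)])
  also have "lwhisker C W q' \<cdot>\<^bsub>P\<^esub> ((rwhisker C q V' \<cdot>\<^bsub>P\<^esub> lwhisker C V p') \<cdot>\<^bsub>P\<^esub> rwhisker C p U')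
      = path_tens C J q q' \<cdot>\<^bsub>P\<^esub> path_tens C J p p'"
    using P.Comp_assoc[OF h(1,6,5)] P.Comp_assoc[OF P.Comp_in[OF h(1,6)] h(5,4)]
    by (simp add: path_tens_eq[OF p p'] path_tens_eq[OF q q'])
  finally show ?thesis .
qed

lemma path_tens_assoc:
  assumes p: "p \<in> hom P U V" and q: "q \<in> hom P W X" and s: "s \<in> hom P Y Z"
  shows "path_tens C J (path_tens C J p q) s = path_tens C J p (path_tens C J q s)"
proof -
  have L: "U \<in> L" "V \<in> L" "W \<in> L" "X \<in> L" "Y \<in> L" "Z \<in> L"
    using assms by (blast intro: P_hom_L)+
  note pq = path_tens_hom[OF p q] and qs = path_tens_hom[OF q s]
  have p1: "rwhisker C p W \<in> hom P (U \<odot> W) (V \<odot> W)" using p L by (blast intro: rwhisker_hom)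
  have q1: "lwhisker C V q \<in> hom P (V \<odot> W) (V \<odot> X)" using q L by (blast intro: lwhisker_hom)
  have q2: "rwhisker C q Y \<in> hom P (W \<odot> Y) (X \<odot> Y)" using q L by (blast intro: rwhisker_hom)
  have s2: "lwhisker C X s \<in> hom P (X \<odot> Y) (X \<odot> Z)" using s L by (blast intro: lwhisker_hom)
  have a: "rwhisker C p (W \<odot> Y) \<in> hom P (U \<odot> (W \<odot> Y)) (V \<odot> (W \<odot> Y))"
    using p L by (blast intro: rwhisker_hom ltens_L)
  have b: "whisker C V q Y \<in> hom P (V \<odot> (W \<odot> Y)) (V \<odot> (X \<odot> Y))"
    using whisker_hom[OF q, of V Y] L by (simp add: ltens_assoc)
  have c: "lwhisker C (V \<odot> X) s \<in> hom P (V \<odot> (X \<odot> Y)) (V \<odot> (X \<odot> Z))"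
    using lwhisker_hom[OF s, of "V \<odot> X"] L by (simp add: ltens_assoc)
  have "path_tens C J (path_tens C J p q) s
      = lwhisker C (V \<odot> X) s \<cdot>\<^bsub>P\<^esub> (whisker C V q Y \<cdot>\<^bsub>P\<^esub> rwhisker C p (W \<odot> Y))"
    using L path_tens_eq[OF pq s] path_tens_eq[OF p q] whisker_Comp[OF p1 q1]
    by (simp add: whisker_whisker[OF p] whisker_whisker[OF q])
  also have "\<dots> = (lwhisker C (V \<odot> X) s \<cdot>\<^bsub>P\<^esub> whisker C V q Y) \<cdot>\<^bsub>P\<^esub> rwhisker C p (W \<odot> Y)"
    by (rule P.Comp_assoc[OF a b c, symmetric])
  also have "\<dots> = path_tens C J p (path_tens C J q s)"
    using L path_tens_eq[OF p qs] path_tens_eq[OF q s] whisker_Comp[OF q2 s2]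
    by (simp add: whisker_whisker[OF q] whisker_whisker[OF s])
  finally show ?thesis .
qed

lemma Q_simps [simp]:
  "Ob Q = L" "Ar Q = Ar (quotient_category P r)" "Dom Q = Dom (quotient_category P r)"
  "Cod Q = Cod (quotient_category P r)" "Id Q A = r `` {Id P A}"
  "Comp Q = Comp (quotient_category P r)"
  "Unit Q = [\<I>]" "TensO Q = ltens C" "TensA Q = class_op r (path_tens C J)"
  by (simp_all add: adjoin_right_dual_def cat.defs mon_cat.defs quotient_category_def)

lemma Q_hom [simp]: "hom Q = hom (quotient_category P r)"
  by (simp add: fun_eq_iff hom_def)

lemma Q_TensA:
  "p \<in> hom P U V \<Longrightarrow> q \<in> hom P W X \<Longrightarrow> class_op r (path_tens C J) (r `` {p}) (r `` {q}) = r `` {path_tens C J p q}"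
  by (rule class_op_class[OF PC.equiv]) (auto simp: hom_def intro: cong_path_tens)

lemma cong_class: "(p, q) \<in> r \<Longrightarrow> r `` {p} = r `` {q}"
  by (rule equiv_class_eq[OF PC.equiv])

lemma path_tens_Id_left: "q \<in> hom P W X \<Longrightarrow> U \<in> L \<Longrightarrow> path_tens C J (Id P U) q = lwhisker C U q"
  using path_tens_eq[OF P.Id_in, of U q W X] P_hom_L[of q W X] whisker_Id[of "[\<I>]" U W]
    P.Id_right[OF lwhisker_hom[of q W X U]] by (simp del: free_category_simps(5,6))

lemma path_tens_Id_right: "q \<in> hom P W X \<Longrightarrow> U \<in> L \<Longrightarrow> path_tens C J q (Id P U) = rwhisker C q U"
  using path_tens_eq[OF _ P.Id_in, of q W X U] P_hom_L[of q W X] whisker_Id[of X U "[\<I>]"]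
    P.Id_left[OF rwhisker_hom[of q W X U]] by (simp del: free_category_simps(5,6))

lemma Q_ArE:
  assumes "F \<in> Ar (quotient_category P r)"
  obtains p U V where "p \<in> hom P U V" "F = r `` {p}"
proof -
  obtain p where "p \<in> Ar P" "F = r `` {p}" using assms by (rule PC.quotient_ArE)
  then show ?thesis using that[of p "Dom P p" "Cod P p"] by (simp add: hom_def)
qed

theorem strict_monoidal_adjoin_right_dual: "strict_monoidal_category Q"
proof -
  interpret QC: category "quotient_category P r" by (rule PC.category_quotient)
  have Q: "category Q"
    using QC.Dom_in QC.Cod_in QC.Id_in QC.Comp_in QC.Id_right QC.Id_left QC.Comp_assoc
    by unfold_locales (simp_all del: free_category_simps(2-))
  show ?thesis
  proof (intro strict_monoidal_category.intro Q, unfold_locales)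
    fix F A B F' A' B' assume "F \<in> hom Q A B" "F' \<in> hom Q A' B'"
    then obtain p p' where p: "p \<in> hom P A B" "F = r `` {p}" and p': "p' \<in> hom P A' B'" "F' = r `` {p'}"
      by (auto elim!: PC.quotient_homE)
    show "F \<boxtimes>\<^bsub>Q\<^esub> F' \<in> hom Q (A \<otimes>\<^bsub>Q\<^esub> A') (B \<otimes>\<^bsub>Q\<^esub> B')"
      using Q_TensA[OF p(1) p'(1)] p p' path_tens_hom[OF p(1) p'(1)] by (simp add: PC.quotient_homI)
  next
    fix A B assume "A \<in> Ob Q" "B \<in> Ob Q"
    then have L: "A \<in> L" "B \<in> L" by auto
    have "path_tens C J (Id P A) (Id P B) = Id P (A \<odot> B)"
      using path_tens_Id_left[OF P.Id_in, of B A] L whisker_Id[of A B "[\<I>]"]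
      by (simp del: free_category_simps(5,6))
    then show "Id Q A \<boxtimes>\<^bsub>Q\<^esub> Id Q B = Id Q (A \<otimes>\<^bsub>Q\<^esub> B)"
      using Q_TensA[OF P.Id_in P.Id_in, of A B] L by (simp del: free_category_simps(5,6))
  next
    fix F A B H D F' A' B' H' D'
    assume "F \<in> hom Q A B" "H \<in> hom Q B D" "F' \<in> hom Q A' B'" "H' \<in> hom Q B' D'"
    then obtain p q p' q' where p: "p \<in> hom P A B" "F = r `` {p}" and q: "q \<in> hom P B D" "H = r `` {q}"
      and p': "p' \<in> hom P A' B'" "F' = r `` {p'}" and q': "q' \<in> hom P B' D'" "H' = r `` {q'}"
      by (auto elim!: PC.quotient_homE)
    show "(H \<cdot>\<^bsub>Q\<^esub> F) \<boxtimes>\<^bsub>Q\<^esub> (H' \<cdot>\<^bsub>Q\<^esub> F') = (H \<boxtimes>\<^bsub>Q\<^esub> H') \<cdot>\<^bsub>Q\<^esub> (F \<boxtimes>\<^bsub>Q\<^esub> F')"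
      using Q_TensA[OF p(1) p'(1)] Q_TensA[OF q(1) q'(1)]
        Q_TensA[OF P.Comp_in[OF p(1) q(1)] P.Comp_in[OF p'(1) q'(1)]]
        PC.quotient_Comp[OF p(1) q(1)] PC.quotient_Comp[OF p'(1) q'(1)]
        PC.quotient_Comp[OF path_tens_hom[OF p(1) p'(1)] path_tens_hom[OF q(1) q'(1)]]
        cong_class[OF path_tens_Comp[OF p(1) q(1) p'(1) q'(1)]] p(2) q(2) p'(2) q'(2)
      by simp
  next
    fix F H K assume "F \<in> Ar Q" "H \<in> Ar Q" "K \<in> Ar Q"
    then obtain p U V q W X s Y Z where p: "p \<in> hom P U V" "F = r `` {p}"
      and q: "q \<in> hom P W X" "H = r `` {q}" and s: "s \<in> hom P Y Z" "K = r `` {s}"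
      by (auto elim!: Q_ArE)
    show "F \<boxtimes>\<^bsub>Q\<^esub> H \<boxtimes>\<^bsub>Q\<^esub> K = F \<boxtimes>\<^bsub>Q\<^esub> (H \<boxtimes>\<^bsub>Q\<^esub> K)"
      using Q_TensA[OF p(1) q(1)] Q_TensA[OF q(1) s(1)] Q_TensA[OF path_tens_hom[OF p(1) q(1)] s(1)]
        Q_TensA[OF p(1) path_tens_hom[OF q(1) s(1)]] path_tens_assoc[OF p(1) q(1) s(1)] p(2) q(2) s(2)
      by simp
  next
    fix F assume "F \<in> Ar Q"
    then obtain p U V where p: "p \<in> hom P U V" "F = r `` {p}" by (auto elim!: Q_ArE)
    show "Id Q \<I>\<^bsub>Q\<^esub> \<boxtimes>\<^bsub>Q\<^esub> F = F" "F \<boxtimes>\<^bsub>Q\<^esub> Id Q \<I>\<^bsub>Q\<^esub> = F"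
      using Q_TensA[OF P.Id_in p(1), of "[\<I>]"] Q_TensA[OF p(1) P.Id_in, of "[\<I>]"] p(2)
        path_tens_Id_left[OF p(1), of "[\<I>]"] path_tens_Id_right[OF p(1), of "[\<I>]"] whisker_unit[OF p(1)]
      by (simp_all del: free_category_simps(5,6))
  qed (auto simp: ltens_assoc)
qed

theorem right_dual_adjoin_right_dual:
  "right_dual Q [J] (Jdual C) (r `` {prim_path C J Eps}) (r `` {prim_path C J Eta})"
proof -
  have J: "Id P [J] \<in> hom P [J] [J]" "Id P (Jdual C) \<in> hom P (Jdual C) (Jdual C)"
    using P.Id_in[of "[J]"] P.Id_in[of "Jdual C"] by (simp_all add: J_in)
  note h = triangle_J_homs
  have 1: "r `` {rwhisker C (prim_path C J Eps) [J] \<cdot>\<^bsub>P\<^esub> lwhisker C [J] (prim_path C J Eta)} = r `` {Id P [J]}"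
    by (rule cong_class[OF cong_base[OF dual_rel_base.triangle_J]])
  have 2: "r `` {lwhisker C (Jdual C) (prim_path C J Eps) \<cdot>\<^bsub>P\<^esub> rwhisker C (prim_path C J Eta) (Jdual C)}
      = r `` {Id P (Jdual C)}"
    by (rule cong_class[OF cong_base[OF dual_rel_base.triangle_Jdual]])
  show ?thesis
    unfolding right_dual_def
    using 1 2 PC.quotient_Comp[OF h(1,2)] PC.quotient_Comp[OF h(4,3)]
      Q_TensA[OF Eps_hom J(1)] Q_TensA[OF J(1) Eta_hom] Q_TensA[OF J(2) Eps_hom] Q_TensA[OF Eta_hom J(2)]
      path_tens_Id_left[OF Eps_hom, of "Jdual C"] path_tens_Id_right[OF Eps_hom, of "[J]"]
      path_tens_Id_left[OF Eta_hom, of "[J]"] path_tens_Id_right[OF Eta_hom, of "Jdual C"]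
      PC.quotient_homI[OF Eps_hom] PC.quotient_homI[OF Eta_hom]
    by (simp add: J_in del: free_category_simps(5,6))
qed

lemma Bar_hom_Ar: "f \<in> Ar C \<Longrightarrow> prim_path C J (Bar f) \<in> hom P [Dom C f] [Cod C f]"
  by (rule Bar_hom) (simp add: hom_def)

theorem strict_monoidal_Omega: "strict_monoidal_functor C Q Omega_ob (Omega_arr C J)"
proof -
  interpret Q: strict_monoidal_category Q by (rule strict_monoidal_adjoin_right_dual)
  show ?thesis
  proof
    fix A assume A: "A \<in> Ob C"
    then show "Omega_ob A \<in> Ob Q" by (simp add: Omega_ob_def)
    show "Omega_arr C J (Id C A) = Id Q (Omega_ob A)"
      using cong_class[OF cong_base[OF dual_rel_base.bar_Id[OF A]]]
      by (simp add: Omega_arr_def Omega_ob_def)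
    fix B assume B: "B \<in> Ob C"
    show "Omega_ob (A \<otimes> B) = Omega_ob A \<otimes>\<^bsub>Q\<^esub> Omega_ob B"
      by (simp add: Omega_ob_def ltens_def)
  next
    fix f A B assume f: "f \<in> hom C A B"
    show "Omega_arr C J f \<in> hom Q (Omega_ob A) (Omega_ob B)"
      using PC.quotient_homI[OF Bar_hom[OF f]] by (simp add: Omega_arr_def Omega_ob_def)
    fix g D assume g: "g \<in> hom C B D"
    show "Omega_arr C J (g \<cdot> f) = Omega_arr C J g \<cdot>\<^bsub>Q\<^esub> Omega_arr C J f"
      using cong_class[OF cong_base[OF dual_rel_base.bar_Comp[OF f g]]]
        PC.quotient_Comp[OF Bar_hom[OF f] Bar_hom[OF g]]
      by (simp add: Omega_arr_def)
  next
    fix f g assume "f \<in> Ar C" "g \<in> Ar C"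
    then obtain A B A' B' where f: "f \<in> hom C A B" and g: "g \<in> hom C A' B'"
      by (auto simp: hom_def)
    then have Ob: "A \<in> Ob C" "B \<in> Ob C" "A' \<in> Ob C" "B' \<in> Ob C"
      using Dom_in Cod_in by (auto simp: hom_def)
    let ?bar = "\<lambda>f. prim_path C J (Bar f)"
    have l: "Id C B \<boxtimes> g \<in> hom C (B \<otimes> A') (B \<otimes> B')" and m: "f \<boxtimes> Id C A' \<in> hom C (A \<otimes> A') (B \<otimes> A')"
      using f g Ob by (auto intro: TensA_in Id_in)
    have e: "f \<boxtimes> g = (Id C B \<boxtimes> g) \<cdot> (f \<boxtimes> Id C A')"
      using TensA_Comp[OF f Id_in[OF Ob(2)] Id_in[OF Ob(3)] g] Id_left[OF f] Id_right[OF g] by simp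
    have "(?bar (f \<boxtimes> g), ?bar (Id C B \<boxtimes> g) \<cdot>\<^bsub>P\<^esub> ?bar (f \<boxtimes> Id C A')) \<in> r"
      unfolding e by (rule cong_base[OF dual_rel_base.bar_Comp[OF m l]])
    also have "(?bar (Id C B \<boxtimes> g) \<cdot>\<^bsub>P\<^esub> ?bar (f \<boxtimes> Id C A'), lwhisker C [B] (?bar g) \<cdot>\<^bsub>P\<^esub> rwhisker C (?bar f) [A']) \<in> r"
    proof (rule comp_cong_hom[OF _ _ Bar_hom[OF m] Bar_hom[OF l]])
      have "Id C B \<boxtimes> g \<boxtimes> Id C \<I> = Id C B \<boxtimes> g" "Id C \<I> \<boxtimes> f \<boxtimes> Id C A' = f \<boxtimes> Id C A'"
        using TensA_unit_right[of "Id C B \<boxtimes> g"] TensA_unit_left[of f] l f by (auto simp: hom_def)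
      then show "(?bar (Id C B \<boxtimes> g), lwhisker C [B] (?bar g)) \<in> r"
        "(?bar (f \<boxtimes> Id C A'), rwhisker C (?bar f) [A']) \<in> r"
        using cong_base[OF dual_rel_base.bar_whisker[of B C \<I> g J]]
          cong_base[OF dual_rel_base.bar_whisker[of \<I> C A' f J]] f g Ob Unit_in
        by (auto simp: hom_def)
    qed
    also have "lwhisker C [B] (?bar g) \<cdot>\<^bsub>P\<^esub> rwhisker C (?bar f) [A'] = path_tens C J (?bar f) (?bar g)"
      by (rule path_tens_eq[OF Bar_hom[OF f] Bar_hom[OF g], symmetric])
    finally show "Omega_arr C J (f \<boxtimes> g) = Omega_arr C J f \<boxtimes>\<^bsub>Q\<^esub> Omega_arr C J g"
      using cong_class Q_TensA[OF Bar_hom[OF f] Bar_hom[OF g]] by (simp add: Omega_arr_def)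
  next
    show "Omega_ob \<I> = \<I>\<^bsub>Q\<^esub>" by (simp add: Omega_ob_def)
  qed
qed

end

end

theory Submission
  imports Defs
begin

text \<open>
  By the string calculus of adjunctions, a morphism from an object \<open>X\<close> of \<open>C\<close> to \<open>U\<^sub>0 \<otimes> J\<^sup>\<or> \<otimes> \<dots> \<otimes> J\<^sup>\<or> \<otimes> U\<^sub>m\<close>
  should be determined by a chain of arrows \<open>X \<rightarrow> U\<^sub>0 \<otimes> Y\<^sub>0\<close>, \<open>J \<otimes> Y\<^sub>0 \<rightarrow> U\<^sub>1 \<otimes> Y\<^sub>1\<close>, \<open>\<dots>\<close>,
  \<open>J \<otimes> Y\<^sub>m\<^sub>-\<^sub>1 \<rightarrow> U\<^sub>m\<close> of \<open>C\<close>: between two consecutive arrows a unit \<open>\<eta>\<close> is inserted, whose \<open>J\<^sup>\<or>\<close> goes to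
  the target and whose \<open>J\<close> is consumed by the next arrow. Two chains are identified if they differ by
  sliding arrows \<open>Y\<^sub>i \<rightarrow> Y\<^sub>i'\<close> past \<open>\<eta>\<close>, so that the chains modulo sliding form an iterated coend.
  For \<open>m = 0\<close> nothing is identified, and a chain is just an arrow of \<open>C\<close>.

  Faithfulness: the edges of the graph act on chains, respecting sliding, and the defining relations
  hold for this action up to sliding. Hence the class of the path \<open>f\<close> determines the result \<open>f\<close> of
  letting it act on the identity chain. Fullness: the morphisms that are represented by chains
  contain the identities and are closed under composition with edges.
\<close>

section \<open>Calculation in strict monoidal categories\<close>

context category
begin

lemma Comp_simps:
  assumes "f \<in> Ar C" "g \<in> Ar C" "Dom C g = Cod C f"
  shows "g \<cdot> f \<in> Ar C" "Dom C (g \<cdot> f) = Dom C f" "Cod C (g \<cdot> f) = Cod C g"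
  using Comp_in[of f "Dom C f" "Cod C f" g "Cod C g"] assms by (simp_all add: hom_def)

lemma Id_simps:
  assumes "A \<in> Ob C"
  shows "Id C A \<in> Ar C" "Dom C (Id C A) = A" "Cod C (Id C A) = A"
  using Id_in[OF assms] by (simp_all add: hom_def)

lemma Comp_Id_simps:
  "f \<in> Ar C \<Longrightarrow> Dom C f = A \<Longrightarrow> f \<cdot> Id C A = f"
  "f \<in> Ar C \<Longrightarrow> Cod C f = A \<Longrightarrow> Id C A \<cdot> f = f"
  using Id_left[of f "Dom C f" A] Id_right[of f A "Cod C f"] by (simp_all add: hom_def)

lemma Comp_assoc_simp:
  "f \<in> Ar C \<Longrightarrow> g \<in> Ar C \<Longrightarrow> k \<in> Ar C \<Longrightarrow> Dom C g = Cod C f \<Longrightarrow> Dom C k = Cod C g \<Longrightarrow>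
    k \<cdot> g \<cdot> f = k \<cdot> (g \<cdot> f)"
  using Comp_assoc[of f "Dom C f" "Cod C f" g "Cod C g" k "Cod C k"] by (simp add: hom_def)

end

context strict_monoidal_category
begin

lemma TensA_simps:
  assumes "f \<in> Ar C" "g \<in> Ar C"
  shows "f \<boxtimes> g \<in> Ar C" "Dom C (f \<boxtimes> g) = Dom C f \<otimes> Dom C g" "Cod C (f \<boxtimes> g) = Cod C f \<otimes> Cod C g"
  using TensA_in[of f "Dom C f" "Cod C f" g "Dom C g" "Cod C g"] assms by (simp_all add: hom_def)

lemma TensA_merge:
  assumes "f \<in> Ar C" "f' \<in> Ar C" "g \<in> Ar C" "g' \<in> Ar C" "Dom C g = Cod C f" "Dom C g' = Cod C f'"
  shows "(g \<boxtimes> g') \<cdot> (f \<boxtimes> f') = (g \<cdot> f) \<boxtimes> (g' \<cdot> f')"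
  using TensA_Comp[of f "Dom C f" "Cod C f" g "Cod C g" f' "Dom C f'" "Cod C f'" g' "Cod C g'"] assms
  by (simp_all add: hom_def)

text \<open>Rewriting brackets composites to the right, which hides two adjacent tensors from
  \<open>TensA_merge\<close> when an arrow \<open>k\<close> precedes them.\<close>

lemma TensA_merge_Comp:
  assumes "f \<in> Ar C" "f' \<in> Ar C" "g \<in> Ar C" "g' \<in> Ar C" "Dom C g = Cod C f" "Dom C g' = Cod C f'"
    and "k \<in> Ar C" "Cod C k = Dom C f \<otimes> Dom C f'"
  shows "(g \<boxtimes> g') \<cdot> ((f \<boxtimes> f') \<cdot> k) = ((g \<cdot> f) \<boxtimes> (g' \<cdot> f')) \<cdot> k"
  using assms by (simp add: TensA_merge[symmetric] Comp_assoc_simp TensA_simps)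

text \<open>\<open>monoidal_simps\<close> splits the identity of a tensor product into a tensor of
  identities, so that it can be merged factor by factor with any other tensor. These rules absorb it
  where the other arrow is not visibly a tensor.\<close>

lemma TensA_Id_Comp:
  assumes "A \<in> Ob C" "B \<in> Ob C" "f \<in> Ar C"
  shows "Cod C f = A \<otimes> B \<Longrightarrow> (Id C A \<boxtimes> Id C B) \<cdot> f = f"
    and "Dom C f = A \<otimes> B \<Longrightarrow> f \<cdot> (Id C A \<boxtimes> Id C B) = f"
    and "Cod C f = A \<otimes> (B \<otimes> D) \<Longrightarrow> D \<in> Ob C \<Longrightarrow> (Id C A \<boxtimes> (Id C B \<boxtimes> Id C D)) \<cdot> f = f"
    and "Cod C f = A \<otimes> (B \<otimes> (D \<otimes> E)) \<Longrightarrow> D \<in> Ob C \<Longrightarrow> E \<in> Ob C \<Longrightarrow>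
      (Id C A \<boxtimes> (Id C B \<boxtimes> (Id C D \<boxtimes> Id C E))) \<cdot> f = f"
  using assms by (simp_all add: TensA_Id TensO_in Comp_Id_simps)

lemmas monoidal_simps = Dom_in Cod_in Comp_simps Id_simps Comp_Id_simps Comp_assoc_simp Unit_in
  TensO_in TensO_assoc TensO_unit_left TensO_unit_right TensA_simps TensA_merge TensA_merge_Comp
  TensA_assoc TensA_unit_left TensA_unit_right TensA_Id[symmetric] TensA_Id_Comp

text \<open>Both sides are \<open>f \<boxtimes> g\<close>. As \<open>Dom C f\<close> is the unit,
  \<open>g\<close> alone is \<open>Id C \<I> \<boxtimes> g\<close>, a tensor that rewriting does not
  see. For fullness, this moves the unit of the duality past an arrow.\<close>

lemma TensA_unit_Dom_swap:
  assumes "f \<in> Ar C" "g \<in> Ar C" "Dom C f = \<I>"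
  shows "(f \<boxtimes> Id C (Cod C g)) \<cdot> g = (Id C (Cod C f) \<boxtimes> g) \<cdot> (f \<boxtimes> Id C (Dom C g))"
  using assms TensA_merge[of "Id C \<I>" g f "Id C (Cod C g)"]
    TensA_merge[of f "Id C (Dom C g)" "Id C (Cod C f)" g]
  by (simp add: Dom_in Cod_in Id_simps Unit_in Comp_Id_simps TensA_unit_left)

text \<open>The functor \<open>A \<otimes> -\<close> is left adjoint to
  \<open>R \<otimes> -\<close>, and the inner composite is the transpose of \<open>m\<close>, so
  transposing back gives \<open>m\<close>: the counit slides past \<open>m\<close> by interchange,
  and a triangle identity remains.\<close>

lemma right_dual_transpose:
  assumes "right_dual C A R e h" "m \<in> Ar C" "Dom C m = A \<otimes> Y" "Y \<in> Ob C"
  shows "(e \<boxtimes> Id C (Cod C m)) \<cdot> (Id C A \<boxtimes> ((Id C R \<boxtimes> m) \<cdot> (h \<boxtimes> Id C Y))) = m"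
proof -
  have eh: "A \<in> Ob C" "R \<in> Ob C" "e \<in> Ar C" "Dom C e = A \<otimes> R" "Cod C e = \<I>"
    "h \<in> Ar C" "Dom C h = \<I>" "Cod C h = R \<otimes> A" and tri: "(e \<boxtimes> Id C A) \<cdot> (Id C A \<boxtimes> h) = Id C A"
    using assms(1) by (auto simp: right_dual_def hom_def)
  note simps = Dom_in Cod_in Comp_simps Id_simps Unit_in TensO_in TensO_assoc TensO_unit_left
    TensO_unit_right TensA_simps
  have 1: "Id C A \<boxtimes> ((Id C R \<boxtimes> m) \<cdot> (h \<boxtimes> Id C Y)) = (Id C (A \<otimes> R) \<boxtimes> m) \<cdot> (Id C A \<boxtimes> h \<boxtimes> Id C Y)"
    using eh assms by (simp add: monoidal_simps)
  have 2: "(e \<boxtimes> Id C (Cod C m)) \<cdot> (Id C (A \<otimes> R) \<boxtimes> m) = m \<cdot> (e \<boxtimes> Id C (A \<otimes> Y))"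
    using eh assms TensA_merge[of "Id C (A \<otimes> R)" m e "Id C (Cod C m)"]
      TensA_merge[of e "Id C (A \<otimes> Y)" "Id C \<I>" m]
    by (simp add: simps Comp_Id_simps TensA_unit_left)
  have 3: "(e \<boxtimes> Id C (A \<otimes> Y)) \<cdot> (Id C A \<boxtimes> h \<boxtimes> Id C Y) = Id C (A \<otimes> Y)"
    using eh assms tri TensA_merge[of "Id C A \<boxtimes> h" "Id C Y" "e \<boxtimes> Id C A" "Id C Y"]
    by (simp add: simps Comp_Id_simps TensA_assoc TensA_Id[symmetric])
  have "(e \<boxtimes> Id C (Cod C m)) \<cdot> (Id C A \<boxtimes> ((Id C R \<boxtimes> m) \<cdot> (h \<boxtimes> Id C Y)))
      = (e \<boxtimes> Id C (Cod C m)) \<cdot> (Id C (A \<otimes> R) \<boxtimes> m) \<cdot> (Id C A \<boxtimes> h \<boxtimes> Id C Y)"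
    unfolding 1 using eh assms by (simp add: simps Comp_assoc_simp)
  also have "\<dots> = m \<cdot> ((e \<boxtimes> Id C (A \<otimes> Y)) \<cdot> (Id C A \<boxtimes> h \<boxtimes> Id C Y))"
    unfolding 2 using eh assms by (simp add: simps Comp_assoc_simp)
  finally show ?thesis unfolding 3 using assms by (simp add: Comp_Id_simps)
qed

end

section \<open>Faithfulness\<close>

context adjoin_dual
begin

text \<open>
  The list \<open>[(f\<^sub>0, Y\<^sub>0), \<dots>, (f\<^sub>m, Y\<^sub>m)]\<close> encodes the chain of the introduction. The last object
  \<open>Y\<^sub>m\<close> is not forced to be the unit here, which allows the last arrow to be treated like the others.
\<close>

fun chain :: "'o \<Rightarrow> 'o list \<Rightarrow> ('m \<times> 'o) list \<Rightarrow> bool" where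
  "chain X [] [] \<longleftrightarrow> True"
| "chain X (B # U) ((f, Y) # s) \<longleftrightarrow>
    B \<in> Ob C \<and> Y \<in> Ob C \<and> f \<in> hom C X (B \<otimes> Y) \<and> chain (J \<otimes> Y) U s"
| "chain _ _ _ \<longleftrightarrow> False"

text \<open>Composition of the morphism encoded by a chain, tensored with \<open>t\<close> on the left, with \<open>f\<close>.\<close>

fun lcomp :: "'o \<Rightarrow> 'm \<Rightarrow> ('m \<times> 'o) list \<Rightarrow> ('m \<times> 'o) list" where
  "lcomp t f [] = []"
| "lcomp t f ((g, Z) # s) = ((Id C t \<boxtimes> g) \<cdot> f, Z) # s"

text \<open>
  The clause for \<open>Eps\<close> contracts the counit with the \<open>\<eta>\<close> in front of the second arrow of the chain,
  by a triangle identity.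
\<close>

fun prim_act :: "'o \<Rightarrow> 'm prim \<Rightarrow> 'o \<Rightarrow> ('m \<times> 'o) list \<Rightarrow> ('m \<times> 'o) list" where
  "prim_act t p w [] = []"
| "prim_act t (Bar g) w ((f, Y) # s) = ((Id C t \<boxtimes> g \<boxtimes> Id C w \<boxtimes> Id C Y) \<cdot> f, Y) # s"
| "prim_act t Eta w ((f, Y) # s) = (f, w \<otimes> Y) # (Id C (J \<otimes> w \<otimes> Y), Y) # s"
| "prim_act t Eps w ((f, Y) # s) = lcomp t f s"

text \<open>
  \<open>act T p (hd W)\<close> is the action of the edge \<open>T \<otimes> p \<otimes> W\<close>; the rest of \<open>W\<close> is not affected.
\<close>

fun act :: "'o list \<Rightarrow> 'm prim \<Rightarrow> 'o \<Rightarrow> ('m \<times> 'o) list \<Rightarrow> ('m \<times> 'o) list" where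
  "act (t # T) p w s = (if T = [] then prim_act t p w s
    else case s of [] \<Rightarrow> [] | x # s' \<Rightarrow> x # act T p w s')"
| "act [] p w s = s"

text \<open>In \<open>step\<close>, the arrow \<open>h\<close> in front of an \<eta> is either
  attached to the arrow before it or, as \<open>Id C J \<boxtimes> h\<close>, precomposed to the
  arrow after it; \<open>lcomp \<I>\<close> is plain precomposition. The condition
  \<open>U \<noteq> []\<close> forbids sliding at the last arrow, which no \<eta> follows.\<close>

inductive slide :: "'o \<Rightarrow> 'o list \<Rightarrow> ('m \<times> 'o) list \<Rightarrow> ('m \<times> 'o) list \<Rightarrow> bool" where
  refl: "chain X U s \<Longrightarrow> slide X U s s"
| sym: "slide X U s s' \<Longrightarrow> slide X U s' s"
| trans [trans]: "slide X U s s' \<Longrightarrow> slide X U s' s'' \<Longrightarrow> slide X U s s''"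
| step: "B \<in> Ob C \<Longrightarrow> f \<in> hom C X (B \<otimes> Y) \<Longrightarrow> h \<in> hom C Y Y' \<Longrightarrow> chain (J \<otimes> Y') U s \<Longrightarrow> U \<noteq> [] \<Longrightarrow>
    slide X (B # U) (((Id C B \<boxtimes> h) \<cdot> f, Y') # s) ((f, Y) # lcomp \<I> (Id C J \<boxtimes> h) s)"
| cons: "B \<in> Ob C \<Longrightarrow> Y \<in> Ob C \<Longrightarrow> f \<in> hom C X (B \<otimes> Y) \<Longrightarrow> slide (J \<otimes> Y) U s s' \<Longrightarrow>
    slide X (B # U) ((f, Y) # s) ((f, Y) # s')"

section \<open>Chains and sliding under composition\<close>

lemma chain_ConsE:
  assumes "chain X (B # U) s"
  obtains f Y s' where "s = (f, Y) # s'" "B \<in> Ob C" "Y \<in> Ob C" "f \<in> Ar C" "Dom C f = X"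
    "Cod C f = B \<otimes> Y" "chain (J \<otimes> Y) U s'"
  using assms by (cases s) (auto simp: hom_def)

lemma chain_lcomp:
  assumes "chain X (B # U) s" "t \<in> Ob C" "f \<in> hom C X' (t \<otimes> X)"
  shows "chain X' ((t \<otimes> B) # U) (lcomp t f s)"
  using assms by (auto elim!: chain_ConsE simp: hom_def monoidal_simps)

lemma slide_chain: "slide X U s s' \<Longrightarrow> chain X U s \<and> chain X U s'"
proof (induction rule: slide.induct)
  case (step B f X Y h Y' U s)
  obtain D U' where U: "U = D # U'" using step by (cases U) auto
  have "chain (J \<otimes> Y) (\<I> \<otimes> D # U') (lcomp \<I> (Id C J \<boxtimes> h) s)"
    using step J_in unfolding U by (intro chain_lcomp) (auto simp: hom_def monoidal_simps)
  moreover have "D \<in> Ob C" using step unfolding U by (auto elim: chain_ConsE)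
  ultimately show ?case using step J_in unfolding U by (auto simp: hom_def monoidal_simps)
qed auto

text \<open>A \<open>step\<close> needs a second arrow in the chain. This is where equivalence of
  chains becomes equality of arrows of \<open>C\<close>.\<close>

lemma slide_short: "slide X U s s' \<Longrightarrow> length U \<le> 1 \<Longrightarrow> s = s'"
  by (induction rule: slide.induct) (auto simp: Suc_le_eq)

text \<open>\<open>lcomp\<close> changes the head arrow on the side of its source, sliding at most
  on the side of its target, so the two commute.\<close>

lemma slide_lcomp:
  assumes "slide X V s s'" "V = w # U" "t \<in> Ob C" "f \<in> hom C X' (t \<otimes> X)"
  shows "slide X' ((t \<otimes> w) # U) (lcomp t f s) (lcomp t f s')"
  using assms
proof (induction arbitrary: w U rule: slide.induct)
  case (refl X U s)
  then show ?case by (auto intro!: slide.refl chain_lcomp)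
next
  case (step B g X Y h Y' U s)
  have "slide X' ((t \<otimes> B) # U) (((Id C (t \<otimes> B) \<boxtimes> h) \<cdot> ((Id C t \<boxtimes> g) \<cdot> f), Y') # s)
    (((Id C t \<boxtimes> g) \<cdot> f, Y) # lcomp \<I> (Id C J \<boxtimes> h) s)"
    using step by (intro slide.step) (auto simp: hom_def monoidal_simps)
  then show ?case using step by (auto simp: hom_def monoidal_simps)
next
  case (cons B Y g X U s s')
  then show ?case by (auto intro!: slide.cons simp: hom_def monoidal_simps)
qed (auto intro: slide.sym slide.trans)

section \<open>The action of edges respects sliding\<close>

lemma ltens_Cons: "T \<noteq> [] \<Longrightarrow> (t # T) \<odot> V = t # (T \<odot> V)"
  by (simp add: ltens_def)

lemma ltens_singleton: "V \<noteq> [] \<Longrightarrow> [t] \<odot> V = (t \<otimes> hd V) # tl V"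
  by (simp add: ltens_def)

lemma ltens_neq_Nil [simp]: "U \<odot> V \<noteq> []"
  by (simp add: ltens_def)

lemma ltens_prim_simps:
  assumes "t \<in> Ob C" "w \<in> Ob C"
  shows "[t] \<odot> [D] \<odot> (w # ws) = (t \<otimes> D \<otimes> w) # ws"
    "[t] \<odot> (Jdual C \<odot> [J]) \<odot> (w # ws) = t # (J \<otimes> w) # ws"
    "[t] \<odot> ([J] \<odot> Jdual C) \<odot> (w # ws) = (t \<otimes> J) # w # ws"
    "[t] \<odot> (w # ws) = (t \<otimes> w) # ws"
  using assms J_in by (simp_all add: ltens_def Jdual_def monoidal_simps)

lemma L_iff: "U \<in> L \<longleftrightarrow> U \<noteq> [] \<and> set U \<subseteq> Ob C"
  by (simp add: obj_lists_def)

text \<open>Only a slide across the first \<eta> interacts with an edge at the head. Slides further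
  along the chain are carried over unchanged or, for \<open>Eps\<close>, become slides of the
  composed tail.\<close>

lemma slide_prim_act:
  assumes "slide X V s s'" "V = [t] \<odot> prim_dom C J p \<odot> (w # ws)"
    and "t \<in> Ob C" "w \<in> Ob C" "p \<in> prims C"
  shows "slide X ([t] \<odot> prim_cod C J p \<odot> (w # ws)) (prim_act t p w s) (prim_act t p w s')"
  using assms
proof (induction rule: slide.induct)
  case (refl X U s)
  have "chain X ([t] \<odot> prim_cod C J p \<odot> (w # ws)) (prim_act t p w s)"
    using refl J_in
    by (cases p) (auto elim!: chain_ConsE simp: ltens_prim_simps hom_def monoidal_simps)
  then show ?case by (rule slide.refl)
next
  case (step B f X Y h Y' U s)
  show ?case
  proof (cases p)
    case (Bar g)
    have "slide X ((t \<otimes> Cod C g \<otimes> w) # ws)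
      (((Id C (t \<otimes> Cod C g \<otimes> w) \<boxtimes> h) \<cdot> ((Id C t \<boxtimes> g \<boxtimes> Id C w \<boxtimes> Id C Y) \<cdot> f), Y') # s)
      (((Id C t \<boxtimes> g \<boxtimes> Id C w \<boxtimes> Id C Y) \<cdot> f, Y) # lcomp \<I> (Id C J \<boxtimes> h) s)"
      using step Bar by (intro slide.step) (auto simp: hom_def monoidal_simps ltens_prim_simps)
    then show ?thesis
      using step Bar by (auto simp: hom_def monoidal_simps ltens_prim_simps)
  next
    case Eta
    have U: "B = t \<otimes> w" "U = ws" using step Eta by (simp_all add: ltens_prim_simps)
    \<comment> \<open>The arrow \<open>h\<close> now has to pass two units: first, as
      \<open>Id C w \<boxtimes> h\<close>, the one just inserted, then the old one.\<close>
    have "slide X (t # (J \<otimes> w) # ws)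
      (((Id C t \<boxtimes> (Id C w \<boxtimes> h)) \<cdot> f, w \<otimes> Y') # (Id C (J \<otimes> w \<otimes> Y'), Y') # s)
      ((f, w \<otimes> Y) # lcomp \<I> (Id C J \<boxtimes> (Id C w \<boxtimes> h)) ((Id C (J \<otimes> w \<otimes> Y'), Y') # s))"
      using step J_in U by (intro slide.step) (auto simp: hom_def monoidal_simps)
    moreover have "slide X (t # (J \<otimes> w) # ws)
      ((f, w \<otimes> Y) # ((Id C (J \<otimes> w) \<boxtimes> h) \<cdot> Id C (J \<otimes> w \<otimes> Y), Y') # s)
      ((f, w \<otimes> Y) # (Id C (J \<otimes> w \<otimes> Y), Y) # lcomp \<I> (Id C J \<boxtimes> h) s)"
      using step J_in U by (intro slide.cons slide.step) (auto simp: hom_def monoidal_simps)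
    ultimately show ?thesis
      using step J_in U Eta
      by (auto simp: hom_def monoidal_simps ltens_prim_simps elim: slide.trans)
  next
    case Eps
    have U: "B = t \<otimes> J" "U = w # ws" using step Eps by (simp_all add: ltens_prim_simps)
    have "chain X (t \<otimes> w # ws) (lcomp t ((Id C (t \<otimes> J) \<boxtimes> h) \<cdot> f) s)"
      using step J_in U by (intro chain_lcomp[of "J \<otimes> Y'"]) (auto simp: hom_def monoidal_simps)
    \<comment> \<open>The \<eta> that \<open>h\<close> slides past is the one that \<epsilon>
      contracts, so both sides contain \<open>h\<close> in the same composite and the two results
      are equal.\<close>
    moreover have "lcomp t ((Id C (t \<otimes> J) \<boxtimes> h) \<cdot> f) s = lcomp t f (lcomp \<I> (Id C J \<boxtimes> h) s)"
      using step J_in U by (auto elim!: chain_ConsE simp: hom_def monoidal_simps)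
    ultimately show ?thesis
      using step U Eps by (auto simp: ltens_prim_simps intro: slide.refl)
  qed
next
  case (cons B Y f X U s s')
  show ?case
  proof (cases p)
    case (Bar g)
    then show ?thesis using cons
      by (auto simp: ltens_prim_simps hom_def monoidal_simps intro!: slide.cons)
  next
    case Eta
    then show ?thesis using cons J_in
      by (auto simp: ltens_prim_simps hom_def monoidal_simps intro!: slide.cons)
  next
    case Eps
    then show ?thesis using cons J_in
      by (auto simp: ltens_prim_simps hom_def monoidal_simps intro!: slide_lcomp)
  qed
qed (auto intro: slide.sym slide.trans)

text \<open>The edge acts on the target of the head arrow or further to the right, while
  \<open>lcomp\<close> acts on its source. For an edge at the head this is the interchange
  law.\<close>

lemma act_lcomp:
  assumes "chain X ((x # T) \<odot> prim_dom C J p \<odot> W) s" "f \<in> hom C X' (t \<otimes> X)"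
    and "t \<in> Ob C" "x \<in> Ob C" "p \<in> prims C" "W \<in> L"
  shows "act ((t \<otimes> x) # T) p (hd W) (lcomp t f s) = lcomp t f (act (x # T) p (hd W) s)"
proof (cases "T = []")
  case False
  then show ?thesis
    using assms by (auto simp: ltens_Cons elim!: chain_ConsE)
next
  case True
  obtain w ws where W: "W = w # ws" "w \<in> Ob C" using assms by (auto elim: L_consE)
  show ?thesis
    using assms J_in True W
    by (cases p) (auto elim!: chain_ConsE simp: ltens_prim_simps hom_def monoidal_simps)
qed

lemma slide_act:
  assumes "slide X (T \<odot> prim_dom C J p \<odot> W) s s'" "T \<in> L" "W \<in> L" "p \<in> prims C"
  shows "slide X (T \<odot> prim_cod C J p \<odot> W) (act T p (hd W) s) (act T p (hd W) s')"
  using assms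
proof (induction T arbitrary: X s s')
  case Nil
  then show ?case by (simp add: L_iff)
next
  case (Cons t T)
  show ?case
  proof (cases "T = []")
    case True
    obtain w ws where W: "W = w # ws" "w \<in> Ob C" using Cons by (auto elim: L_consE)
    show ?thesis using slide_prim_act[OF Cons.prems(1)[unfolded True W(1)] HOL.refl] Cons.prems W True
      by (simp add: L_iff)
  next
    case False
    then have T: "T \<in> L" "t \<in> Ob C" using Cons.prems by (auto simp: L_iff)
    let ?U = "T \<odot> prim_dom C J p \<odot> W" and ?V = "T \<odot> prim_cod C J p \<odot> W"
    have IH: "slide X ?U s s' \<Longrightarrow> slide X ?V (act T p (hd W) s) (act T p (hd W) s')" for X s s'
      using Cons T by blast
    have U: "(t # T) \<odot> prim_dom C J p \<odot> W = t # ?U" "(t # T) \<odot> prim_cod C J p \<odot> W = t # ?V"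
      using False by (simp_all add: ltens_Cons)
    define A where "A = act (t # T) p (hd W)"
    have A: "A (x # s) = x # act T p (hd W) s" for x s using False by (simp add: A_def)
    have "slide X (t # ?V) (A s) (A s')" if "slide X U' s s'" "U' = t # ?U" for X U' s s'
      using that
    proof (induction rule: slide.induct)
      case (refl X U s)
      then obtain f Y s1 where s: "s = (f, Y) # s1" "f \<in> hom C X (t \<otimes> Y)" "Y \<in> Ob C" "chain (J \<otimes> Y) ?U s1"
        by (auto elim!: chain_ConsE simp: hom_def)
      show ?case using s IH[OF slide.refl[OF s(4)]] T by (simp add: A slide.cons)
    next
      case (step B f X Y h Y' U s)
      obtain t1 T1 where T1: "T = t1 # T1" "t1 \<in> Ob C" using T by (auto elim: L_consE)
      have c: "chain (J \<otimes> Y') ?U s" using step by simp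
      have h: "h \<in> Ar C" "Dom C h = Y" "Cod C h = Y'" "Y \<in> Ob C" "Y' \<in> Ob C"
        using step Dom_in Cod_in by (auto simp: hom_def)
      \<comment> \<open>Sliding puts \<open>h\<close> in front of the tail. Taking it out of the
        action on the tail makes both sides a single \<open>step\<close> over the tail already acted
        on.\<close>
      have "act T p (hd W) (lcomp \<I> (Id C J \<boxtimes> h) s) = lcomp \<I> (Id C J \<boxtimes> h) (act T p (hd W) s)"
        using act_lcomp[OF c[unfolded T1(1)], of "Id C J \<boxtimes> h" "J \<otimes> Y" \<I>] T1 step h J_in Cons.prems
        by (simp add: hom_def monoidal_simps del: act.simps)
      moreover have "chain (J \<otimes> Y') ?V (act T p (hd W) s)"
        using IH[OF slide.refl[OF c]] slide_chain by blast
      ultimately show ?case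
        using step by (auto simp: A intro!: slide.step)
    next
      case (cons B Y f X U s s')
      then show ?case using IH by (simp add: A slide.cons)
    qed (auto intro: slide.sym slide.trans)
    then show ?thesis using Cons.prems unfolding U A_def by blast
  qed
qed

lemma chain_act:
  "chain X (T \<odot> prim_dom C J p \<odot> W) s \<Longrightarrow> T \<in> L \<Longrightarrow> W \<in> L \<Longrightarrow> p \<in> prims C \<Longrightarrow>
    chain X (T \<odot> prim_cod C J p \<odot> W) (act T p (hd W) s)"
  using slide_act[OF slide.refl] slide_chain by blast

definition edge_act :: "('o, 'm) edge \<Rightarrow> ('m \<times> 'o) list \<Rightarrow> ('m \<times> 'o) list" where
  "edge_act a = (case a of (T, p, W) \<Rightarrow> act T p (hd W))"

lemma slide_edge_act:
  "slide X (tail G a) s s' \<Longrightarrow> a \<in> arcs G \<Longrightarrow> slide X (head G a) (edge_act a s) (edge_act a s')"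
  by (cases a) (auto simp: edge_act_def intro: slide_act)

section \<open>The defining relations hold for the action up to sliding\<close>

text \<open>For this relation, the two functoriality relations and the two triangles, both sides act
  equally, not only up to sliding. Induction on \<open>T\<close> strips the untouched arrows; what
  remains is a calculation in \<open>C\<close>.\<close>

lemma act_Bar_whisker:
  assumes "chain X (T \<odot> [E \<otimes> Dom C f \<otimes> F] \<odot> W) s" "T \<in> L" "W \<in> L"
    and "E \<in> Ob C" "F \<in> Ob C" "f \<in> Ar C"
  shows "act T (Bar (Id C E \<boxtimes> f \<boxtimes> Id C F)) (hd W) s = act (T \<odot> [E]) (Bar f) (F \<otimes> hd W) s"
  using assms
proof (induction T arbitrary: X s)
  case (Cons t T)
  obtain w ws where W: "W = w # ws" "w \<in> Ob C" using Cons by (auto elim: L_consE)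
  show ?case
  proof (cases "T = []")
    case True
    then show ?thesis using Cons.prems W
      by (auto simp: L_iff ltens_def elim!: chain_ConsE) (simp_all add: monoidal_simps)
  next
    case False
    then have "T \<in> L" using Cons.prems by (auto simp: L_iff)
    then show ?thesis using Cons False
      by (auto simp: ltens_Cons elim!: chain_ConsE)
  qed
qed (simp add: L_iff)

lemma act_Bar_Id:
  assumes "chain X (T \<odot> [A] \<odot> W) s" "T \<in> L" "W \<in> L" "A \<in> Ob C"
  shows "act T (Bar (Id C A)) (hd W) s = s"
  using assms
proof (induction T arbitrary: X s)
  case (Cons t T)
  obtain w ws where W: "W = w # ws" "w \<in> Ob C" using Cons by (auto elim: L_consE)
  show ?case
  proof (cases "T = []")
    case True
    then show ?thesis using Cons.prems W
      by (auto simp: L_iff ltens_def elim!: chain_ConsE)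
        (simp_all add: monoidal_simps TensA_Id_Comp)
  next
    case False
    then have "T \<in> L" using Cons.prems by (auto simp: L_iff)
    then show ?thesis using Cons False
      by (auto simp: ltens_Cons elim!: chain_ConsE)
  qed
qed (simp add: L_iff)

lemma act_Bar_Comp:
  assumes "chain X (T \<odot> [A] \<odot> W) s" "T \<in> L" "W \<in> L" "f \<in> hom C A B" "g \<in> hom C B D"
  shows "act T (Bar (g \<cdot> f)) (hd W) s = act T (Bar g) (hd W) (act T (Bar f) (hd W) s)"
  using assms
proof (induction T arbitrary: X s)
  case (Cons t T)
  obtain w ws where W: "W = w # ws" "w \<in> Ob C" using Cons by (auto elim: L_consE)
  show ?case
  proof (cases "T = []")
    case True
    then show ?thesis using Cons.prems W
      by (auto simp: L_iff ltens_def hom_def elim!: chain_ConsE) (simp_all add: monoidal_simps)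
  next
    case False
    then have "T \<in> L" using Cons.prems by (auto simp: L_iff)
    then show ?thesis using Cons False
      by (auto simp: ltens_Cons elim!: chain_ConsE)
  qed
qed (simp add: L_iff)

text \<open>The \<eta> inserts an identity as the next arrow of the chain, and the \<epsilon>
  composes the arrow before it with this identity.\<close>

lemma act_triangle_J:
  assumes "chain X (T \<odot> [J] \<odot> W) s" "T \<in> L" "W \<in> L"
  shows "act T Eps w' (act (T \<odot> [J]) Eta (hd W) s) = s"
  using assms
proof (induction T arbitrary: X s)
  case (Cons t T)
  obtain w ws where W: "W = w # ws" "w \<in> Ob C" using Cons by (auto elim: L_consE)
  show ?case
  proof (cases "T = []")
    case True
    then show ?thesis using Cons.prems W J_in
      by (auto simp: L_iff ltens_def elim!: chain_ConsE)
        (simp_all add: monoidal_simps TensA_Id_Comp)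
  next
    case False
    then have "T \<in> L" using Cons.prems by (auto simp: L_iff)
    then show ?thesis using Cons False
      by (auto simp: ltens_Cons elim!: chain_ConsE)
  qed
qed (simp add: L_iff)

text \<open>The \<eta> puts an identity between two arrows of the chain, and the \<epsilon> composes
  this identity with the second of them.\<close>

lemma act_triangle_Jdual:
  assumes "chain X (T \<odot> Jdual C \<odot> W) s" "T \<in> L" "W \<in> L"
  shows "act (T \<odot> Jdual C) Eps w' (act T Eta \<I> s) = s"
  using assms
proof (induction T arbitrary: X s)
  case (Cons t T)
  obtain w ws where W: "W = w # ws" "w \<in> Ob C" using Cons by (auto elim: L_consE)
  show ?case
  proof (cases "T = []")
    case True
    then show ?thesis using Cons.prems W J_in
      by (auto simp: L_iff ltens_def Jdual_def elim!: chain_ConsE)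
        (simp_all add: monoidal_simps TensA_Id_Comp)
  next
    case False
    then have "T \<in> L" using Cons.prems by (auto simp: L_iff)
    then show ?thesis using Cons False
      by (auto simp: ltens_Cons elim!: chain_ConsE)
  qed
qed (simp add: L_iff)

text \<open>Any head arrow arises by \<open>lcomp\<close> from an identity, so an action that
  commutes with \<open>lcomp\<close> is determined by its value there.\<close>

lemma lcomp_Id_head:
  assumes "t \<in> Ob C" "x \<in> Ob C" "Y \<in> Ob C" "f \<in> Ar C" "Cod C f = t \<otimes> (x \<otimes> Y)"
  shows "lcomp t f ((Id C (x \<otimes> Y), Y) # s) = (f, Y) # s"
  using assms by (simp add: TensA_Id TensO_in Comp_Id_simps)

text \<open>
  An edge whose position is at or to the right of the head arrow \<open>f\<close> of a chain acts by composing
  \<open>f\<close> with an arrow \<open>t \<otimes> g\<close> that depends neither on \<open>f\<close> nor on \<open>t\<close>. This makes all instances of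
  the exchange relation uniform in the second edge.
\<close>

lemma act_head:
  assumes "chain X ((t \<otimes> x0) # U) ((f, Y) # s)" "(x # T) \<odot> prim_dom C J q \<odot> W = x0 # U"
    and "t \<in> Ob C" "x0 \<in> Ob C" "q \<in> prims C" "x # T \<in> L" "W \<in> L"
  obtains x1 U' Z g s' where
    "(x # T) \<odot> prim_cod C J q \<odot> W = x1 # U'" "x1 \<in> Ob C" "Z \<in> Ob C"
    "g \<in> Ar C" "Dom C g = x0 \<otimes> Y" "Cod C g = x1 \<otimes> Z" "chain (J \<otimes> Z) U' s'"
    "\<And>t f X. t \<in> Ob C \<Longrightarrow> f \<in> hom C X (t \<otimes> (x0 \<otimes> Y)) \<Longrightarrow>
      act ((t \<otimes> x) # T) q (hd W) ((f, Y) # s) = ((Id C t \<boxtimes> g) \<cdot> f, Z) # s'"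
proof -
  have Y: "Y \<in> Ob C" and c: "chain (x0 \<otimes> Y) (x0 # U) ((Id C (x0 \<otimes> Y), Y) # s)"
    using assms by (auto simp: hom_def monoidal_simps)
  note c = c[folded assms(2)]
  have V: "(x # T) \<odot> prim_cod C J q \<odot> W \<in> L"
    using assms by simp
  then obtain x1 U' where x1: "(x # T) \<odot> prim_cod C J q \<odot> W = x1 # U'" "x1 \<in> Ob C"
    by (auto elim: L_consE)
  \<comment> \<open>As in the Yoneda lemma, \<open>g\<close> is the result of acting on the chain
    with an identity at its head.\<close>
  obtain g Z s' where g: "act (x # T) q (hd W) ((Id C (x0 \<otimes> Y), Y) # s) = (g, Z) # s'"
    "Z \<in> Ob C" "g \<in> Ar C" "Dom C g = x0 \<otimes> Y" "Cod C g = x1 \<otimes> Z" "chain (J \<otimes> Z) U' s'"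
    using chain_act[OF c assms(6,7,5)] unfolding x1 by (auto elim!: chain_ConsE)
  have x: "x \<in> Ob C" using assms by (simp add: L_iff)
  show ?thesis
  proof (rule that[OF x1(1,2) g(2-6)])
    fix t f X assume t: "t \<in> Ob C" "f \<in> hom C X (t \<otimes> (x0 \<otimes> Y))"
    then show "act ((t \<otimes> x) # T) q (hd W) ((f, Y) # s) = ((Id C t \<boxtimes> g) \<cdot> f, Z) # s'"
      using act_lcomp[OF c t(2,1) x assms(5,7)] lcomp_Id_head[of t x0 Y f s] Y assms(4) g(1)
      by (simp add: hom_def del: act.simps)
  qed
qed

text \<open>This is where chains have to be taken modulo sliding. For \<open>Bar\<close> and
  \<open>Eps\<close> both orders give the same chain. For \<open>Eta\<close>, the second edge
  contributes its arrow \<open>g\<close> behind the new \<eta> if it acts last, and in front of it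
  if it acts first; the two chains differ by sliding \<open>g\<close> past this \<eta>.\<close>

lemma slide_exchange_prim:
  assumes "chain X ([t] \<odot> prim_dom C J p \<odot> (S \<odot> prim_dom C J q \<odot> W)) s"
    and "t \<in> Ob C" "p \<in> prims C" "q \<in> prims C" "S \<in> L" "W \<in> L"
  shows "slide X ([t] \<odot> prim_cod C J p \<odot> (S \<odot> prim_cod C J q \<odot> W))
    (act ([t] \<odot> prim_cod C J p \<odot> S) q (hd W) (prim_act t p (hd (S \<odot> prim_dom C J q \<odot> W)) s))
    (prim_act t p (hd (S \<odot> prim_cod C J q \<odot> W)) (act ([t] \<odot> prim_dom C J p \<odot> S) q (hd W) s))"
proof -
  have "S \<odot> prim_dom C J q \<odot> W \<in> L" using assms by simp
  then obtain x0 U where x0: "S \<odot> prim_dom C J q \<odot> W = x0 # U" "x0 \<in> Ob C"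
    by (auto elim: L_consE)
  obtain x T where x: "S = x # T" "x \<in> Ob C" using assms by (auto elim: L_consE)
  have xT: "x # T \<in> L" and x0': "(x # T) \<odot> prim_dom C J q \<odot> W = x0 # U" using assms x x0 by auto
  show ?thesis
  proof (cases p)
    case (Bar k)
    then have k: "k \<in> Ar C" using assms by simp
    have c0: "chain X ((t \<otimes> Dom C k \<otimes> x0) # U) s"
      using assms(1,2) x0 Bar by (simp add: ltens_prim_simps)
    then obtain f Y s1 where s: "s = (f, Y) # s1" "Y \<in> Ob C" "f \<in> Ar C" "Dom C f = X"
      "Cod C f = t \<otimes> Dom C k \<otimes> x0 \<otimes> Y"
      by (rule chain_ConsE)
    note c = c0[unfolded s(1)]
    have tk: "t \<otimes> Dom C k \<in> Ob C" "t \<otimes> Cod C k \<in> Ob C" using assms k by (simp_all add: monoidal_simps)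
    obtain x1 U' Z g s' where g: "(x # T) \<odot> prim_cod C J q \<odot> W = x1 # U'" "x1 \<in> Ob C" "Z \<in> Ob C"
      "g \<in> Ar C" "Dom C g = x0 \<otimes> Y" "Cod C g = x1 \<otimes> Z" "chain (J \<otimes> Z) U' s'"
      and a: "\<And>t f X. t \<in> Ob C \<Longrightarrow> f \<in> hom C X (t \<otimes> (x0 \<otimes> Y)) \<Longrightarrow>
        act ((t \<otimes> x) # T) q (hd W) ((f, Y) # s1) = ((Id C t \<boxtimes> g) \<cdot> f, Z) # s'"
      by (rule act_head[OF c x0' tk(1) x0(2) assms(4) xT assms(6)]) (rule that)
    have a1: "act ((t \<otimes> Dom C k \<otimes> x) # T) q (hd W) ((f, Y) # s1) = ((Id C (t \<otimes> Dom C k) \<boxtimes> g) \<cdot> f, Z) # s'"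
      using s k assms x0 by (intro a[OF tk(1)]) (auto simp: hom_def monoidal_simps)
    have a2: "act ((t \<otimes> Cod C k \<otimes> x) # T) q (hd W) (((Id C t \<boxtimes> k \<boxtimes> Id C x0 \<boxtimes> Id C Y) \<cdot> f, Y) # s1)
        = ((Id C (t \<otimes> Cod C k) \<boxtimes> g) \<cdot> ((Id C t \<boxtimes> k \<boxtimes> Id C x0 \<boxtimes> Id C Y) \<cdot> f), Z) # s'"
      using s k assms x0 by (intro a[OF tk(2)]) (auto simp: hom_def monoidal_simps)
    let ?h = "(Id C t \<boxtimes> k \<boxtimes> Id C x1 \<boxtimes> Id C Z) \<cdot> ((Id C (t \<otimes> Dom C k) \<boxtimes> g) \<cdot> f)"
    have "(Id C (t \<otimes> Cod C k) \<boxtimes> g) \<cdot> ((Id C t \<boxtimes> k \<boxtimes> Id C x0 \<boxtimes> Id C Y) \<cdot> f) = ?h"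
      using s g k assms(2) x0 by (simp add: monoidal_simps)
    moreover have "chain X ((t \<otimes> Cod C k \<otimes> x1) # U') ((?h, Z) # s')"
      using s g k assms(2) x0 by (simp add: hom_def monoidal_simps)
    ultimately show ?thesis
      unfolding x(1) x0' g(1) Bar s(1)
      using a1 a2 assms(2) x(2) x0(2) g(2)
      by (simp add: ltens_prim_simps slide.refl del: act.simps chain.simps)
  next
    case Eta
    have c0: "chain X ((t \<otimes> x0) # U) s"
      using assms(1,2) x0 Eta by (simp add: ltens_prim_simps)
    then obtain f Y s1 where s: "s = (f, Y) # s1" "Y \<in> Ob C" "f \<in> Ar C" "Dom C f = X"
      "Cod C f = t \<otimes> x0 \<otimes> Y"
      by (rule chain_ConsE)
    note c = c0[unfolded s(1)]
    obtain x1 U' Z g s' where g: "(x # T) \<odot> prim_cod C J q \<odot> W = x1 # U'" "x1 \<in> Ob C" "Z \<in> Ob C"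
      "g \<in> Ar C" "Dom C g = x0 \<otimes> Y" "Cod C g = x1 \<otimes> Z" "chain (J \<otimes> Z) U' s'"
      and a: "\<And>t f X. t \<in> Ob C \<Longrightarrow> f \<in> hom C X (t \<otimes> (x0 \<otimes> Y)) \<Longrightarrow>
        act ((t \<otimes> x) # T) q (hd W) ((f, Y) # s1) = ((Id C t \<boxtimes> g) \<cdot> f, Z) # s'"
      by (rule act_head[OF c x0' assms(2) x0(2) assms(4) xT assms(6)]) (rule that)
    have a1: "act ((t \<otimes> x) # T) q (hd W) ((f, Y) # s1) = ((Id C t \<boxtimes> g) \<cdot> f, Z) # s'"
      using s assms x0 by (intro a) (auto simp: hom_def monoidal_simps)
    have a2: "act ((J \<otimes> x) # T) q (hd W) ((Id C (J \<otimes> x0 \<otimes> Y), Y) # s1)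
        = ((Id C J \<boxtimes> g) \<cdot> Id C (J \<otimes> x0 \<otimes> Y), Z) # s'"
      using s assms x0 J_in by (intro a) (auto simp: hom_def monoidal_simps)
    have l: "lcomp \<I> (Id C J \<boxtimes> g) ((Id C (J \<otimes> x1 \<otimes> Z), Z) # s')
        = ((Id C J \<boxtimes> g) \<cdot> Id C (J \<otimes> x0 \<otimes> Y), Z) # s'"
      using s x0 g J_in by (simp add: monoidal_simps)
    have "slide X (t # (J \<otimes> x1) # U')
        (((Id C t \<boxtimes> g) \<cdot> f, x1 \<otimes> Z) # (Id C (J \<otimes> x1 \<otimes> Z), Z) # s')
        ((f, x0 \<otimes> Y) # lcomp \<I> (Id C J \<boxtimes> g) ((Id C (J \<otimes> x1 \<otimes> Z), Z) # s'))"
      using s assms(2) x0 g J_in by (intro slide.step) (simp_all add: hom_def monoidal_simps)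
    note slide.sym[OF this[unfolded l]]
    moreover have "act ([t] \<odot> prim_cod C J Eta \<odot> (x # T)) q (hd W) (prim_act t Eta x0 ((f, Y) # s1))
        = (f, x0 \<otimes> Y) # ((Id C J \<boxtimes> g) \<cdot> Id C (J \<otimes> x0 \<otimes> Y), Z) # s'"
      using a2 assms(2) x(2) by (simp add: ltens_prim_simps)
    moreover have "prim_act t Eta x1 (act ([t] \<odot> prim_dom C J Eta \<odot> (x # T)) q (hd W) ((f, Y) # s1))
        = ((Id C t \<boxtimes> g) \<cdot> f, x1 \<otimes> Z) # (Id C (J \<otimes> x1 \<otimes> Z), Z) # s'"
      using a1 assms(2) x(2) by (simp add: ltens_prim_simps del: act.simps)
    moreover have "[t] \<odot> prim_cod C J Eta \<odot> (x1 # U') = t # (J \<otimes> x1) # U'"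
      using assms(2) g(2) by (simp add: ltens_prim_simps)
    ultimately show ?thesis
      unfolding x(1) x0' g(1) Eta s(1) list.sel by (simp only:)
  next
    case Eps
    have c: "chain X ((t \<otimes> J) # S \<odot> prim_dom C J q \<odot> W) s"
      using assms(1,2) x0 Eps by (simp add: ltens_prim_simps)
    then obtain f Y s1 where s: "s = (f, Y) # s1" "Y \<in> Ob C" "f \<in> Ar C" "Dom C f = X"
      "Cod C f = t \<otimes> (J \<otimes> Y)" and c1: "chain (J \<otimes> Y) (S \<odot> prim_dom C J q \<odot> W) s1"
      using assms J_in by (auto elim!: chain_ConsE simp: monoidal_simps)
    have "S \<odot> prim_cod C J q \<odot> W \<in> L" using assms by simp
    then obtain x1 U' where x1: "S \<odot> prim_cod C J q \<odot> W = x1 # U'" "x1 \<in> Ob C"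
      by (auto elim: L_consE)
    have f: "f \<in> hom C X (t \<otimes> (J \<otimes> Y))" using s by (simp add: hom_def)
    have a: "act ((t \<otimes> x) # T) q (hd W) (lcomp t f s1) = lcomp t f (act S q (hd W) s1)"
      using act_lcomp[OF c1[unfolded x(1)] f assms(2) x(2) assms(4,6)] x by simp
    have "chain X ((t \<otimes> x1) # U') (lcomp t f (act S q (hd W) s1))"
      using chain_act[OF c1 assms(5,6,4)] assms(2) f unfolding x1 by (intro chain_lcomp)
    then have "slide X ((t \<otimes> x1) # U') (act ((t \<otimes> x) # T) q (hd W) (lcomp t f s1))
        (lcomp t f (act S q (hd W) s1))"
      unfolding a by (rule slide.refl)
    then show ?thesis
      unfolding x0 x1 Eps s(1) unfolding x(1)
      using assms(2) x(2) x1(2) by (simp add: ltens_prim_simps)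
  qed
qed

lemma slide_exchange:
  assumes "chain X (T \<odot> prim_dom C J p \<odot> (S \<odot> prim_dom C J q \<odot> W)) s"
    and "T \<in> L" "p \<in> prims C" "q \<in> prims C" "S \<in> L" "W \<in> L"
  shows "slide X (T \<odot> prim_cod C J p \<odot> (S \<odot> prim_cod C J q \<odot> W))
    (act (T \<odot> prim_cod C J p \<odot> S) q (hd W) (act T p (hd (S \<odot> prim_dom C J q \<odot> W)) s))
    (act T p (hd (S \<odot> prim_cod C J q \<odot> W)) (act (T \<odot> prim_dom C J p \<odot> S) q (hd W) s))"
  using assms
proof (induction T arbitrary: X s)
  case (Cons t T)
  show ?case
  proof (cases "T = []")
    case True
    then show ?thesis using slide_exchange_prim Cons.prems by (simp add: L_iff)
  next
    case False
    then have "T \<in> L" using Cons.prems by (auto simp: L_iff)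
    then show ?thesis using Cons False
      by (auto simp: ltens_Cons hom_def elim!: chain_ConsE intro!: slide.cons)
  qed
qed (simp add: L_iff)

section \<open>The action of paths modulo the congruence\<close>

definition path_act :: "('o list, ('o, 'm) edge) path \<Rightarrow> ('m \<times> 'o) list \<Rightarrow> ('m \<times> 'o) list" where
  "path_act p = (case p of (u, es, v) \<Rightarrow> fold edge_act es)"

lemma path_act_Comp:
  "p \<in> hom P A B \<Longrightarrow> q \<in> hom P B D \<Longrightarrow> path_act (q \<cdot>\<^bsub>P\<^esub> p) s = path_act q (path_act p s)"
  by (elim P_homE) (simp add: path_act_def)

lemma slide_path_act:
  assumes "p \<in> hom P A B" "slide X A s s'"
  shows "slide X B (path_act p s) (path_act p s')"
proof -
  obtain es where es: "p = (A, es, B)" "G.awalk A es B" using assms(1) by (rule P_homE)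
  from es(2) assms(2) have "slide X B (fold edge_act es s) (fold edge_act es s')"
  proof (induction es arbitrary: A s s')
    case (Cons a es)
    then show ?case using slide_edge_act[of X a s s'] by (auto simp: G.awalk_Cons_iff)
  qed (auto simp: G.awalk_Nil_iff)
  then show ?thesis by (simp add: es path_act_def)
qed

text \<open>The relations were checked at an arbitrary position in a list, so whiskering by
  \<open>S\<close> and \<open>Z\<close> only changes that position.\<close>

lemma slide_dual_rel:
  assumes "(p, q) \<in> dual_rel C J" "chain X (Dom P p) s"
  shows "slide X (Cod P p) (path_act p s) (path_act q s)"
proof -
  obtain S p' q' Z where L: "S \<in> L" "Z \<in> L" and r: "(p', q') \<in> dual_rel_base C J"
    and pq: "p = whisker C S p' Z" "q = whisker C S q' Z"
    using assms(1) by (rule dual_relE)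
  have p_hom: "p \<in> hom P (Dom P p) (Cod P p)"
    using dual_rel_parallel[OF assms(1)] by (simp add: hom_def)
  have eq: ?thesis if "path_act p s = path_act q s"
    using slide_path_act[OF p_hom slide.refl[OF assms(2)]] that by simp
  note defs = whisker_def edge_path_def prim_edge_def whisker_edge_def edge_act_def path_act_def
  from r show ?thesis
  proof cases
    case (bar_whisker E F f)
    obtain z zs where z: "Z = z # zs" "z \<in> Ob C" using L by (auto elim: L_consE)
    have "chain X (S \<odot> [E \<otimes> Dom C f \<otimes> F] \<odot> Z) s"
      using assms(2) bar_whisker L by (simp add: pq defs monoidal_simps)
    from act_Bar_whisker[OF this L] bar_whisker L z show ?thesis
      by (intro eq) (simp add: pq defs, simp add: ltens_def)
  next
    case (bar_Id A)
    then have "chain X (S \<odot> [A] \<odot> Z) s"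
      using assms(2) L by (simp add: pq defs monoidal_simps)
    from act_Bar_Id[OF this L] bar_Id L show ?thesis
      by (intro eq) (simp add: pq defs)
  next
    case (bar_Comp f A B g D)
    have h: "f \<in> Ar C" "g \<in> Ar C" "Dom C f = A" "Cod C f = B" "Dom C g = B" "Cod C g = D"
      "A \<in> Ob C" "B \<in> Ob C" "D \<in> Ob C"
      using bar_Comp Dom_in Cod_in by (auto simp: hom_def)
    then have "chain X (S \<odot> [A] \<odot> Z) s"
      using assms(2) L bar_Comp by (simp add: pq defs monoidal_simps)
    from act_Bar_Comp[OF this L] bar_Comp h L show ?thesis
      by (intro eq) (simp add: pq defs)
  next
    case (exchange a b U V W Y)
    obtain T1 p1 W1 where a: "a = (T1, p1, W1)" by (cases a)
    obtain T2 p2 W2 where b: "b = (T2, p2, W2)" by (cases b)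
    have A: "T1 \<in> L" "p1 \<in> prims C" "W1 \<in> L" "T2 \<in> L" "p2 \<in> prims C" "W2 \<in> L"
      using exchange a b by auto
    have "chain X ((S \<odot> T1) \<odot> prim_dom C J p1 \<odot> ((W1 \<odot> T2) \<odot> prim_dom C J p2 \<odot> (W2 \<odot> Z))) s"
      using assms(2) exchange A L by (simp add: pq defs a b ltens_assoc)
    from slide_exchange[OF this] exchange A L show ?thesis
      by (simp add: pq defs a b ltens_assoc)
  next
    case triangle_J
    have "chain X (S \<odot> [J] \<odot> Z) s"
      using assms(2) L triangle_J J_in by (simp add: pq defs ltens_assoc)
    from act_triangle_J[OF this L] triangle_J L J_in show ?thesis
      by (intro eq) (simp add: pq defs ltens_assoc)
  next
    case triangle_Jdual
    obtain z zs where z: "Z = z # zs" "z \<in> Ob C" using L by (auto elim: L_consE)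
    have "chain X (S \<odot> Jdual C \<odot> Z) s"
      using assms(2) L triangle_Jdual J_in by (simp add: pq defs ltens_assoc)
    from act_triangle_Jdual[OF this L] triangle_Jdual L J_in z show ?thesis
      by (intro eq) (simp add: pq defs ltens_assoc, simp add: ltens_def Jdual_def)
  qed
qed

lemma slide_cong:
  assumes "(p, q) \<in> r" "chain X (Dom P p) s"
  shows "slide X (Cod P p) (path_act p s) (path_act q s)"
  using assms unfolding dual_cong_def
proof (induction arbitrary: s)
  case (incl p q)
  then show ?case by (rule slide_dual_rel)
next
  case (refl p)
  then show ?case
    using slide_path_act[of p "Dom P p" "Cod P p" X s s] by (simp add: hom_def slide.refl)
next
  case (sym p q)
  have "Dom P p = Dom P q" "Cod P p = Cod P q"
    using PC.parallel[of p q] sym by (simp_all add: dual_cong_def)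
  then show ?case using sym by (auto intro: slide.sym)
next
  case (trans p q t)
  have "Dom P p = Dom P q" "Cod P p = Cod P q"
    using PC.parallel[of p q] trans by (simp_all add: dual_cong_def)
  then show ?case using trans by (auto intro: slide.trans)
next
  case (comp p p' q q')
  note p = cong_hom[of p p', unfolded dual_cong_def, OF comp(1)]
  note q = cong_hom[of q q', unfolded dual_cong_def, OF comp(2)]
  have s: "slide X (Dom P q) (path_act p s) (path_act p' s)"
    using comp.IH(1)[OF comp.prems[unfolded homD(2)[OF P.Comp_in[OF p(1) q(1)[folded comp(3)]]]]] comp(3)
    by simp
  then have "slide X (Cod P q) (path_act q (path_act p s)) (path_act q' (path_act p s))"
    using slide_chain comp.IH(2) by blast
  also note slide_path_act[OF q(2) s]
  finally show ?case
    using path_act_Comp[OF p(1) q(1)[folded comp(3)]] path_act_Comp[OF p(2) q(2)[folded comp(3)]]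
      homD(3)[OF P.Comp_in[OF p(1) q(1)[folded comp(3)]]] by simp
qed

lemma Omega_faithful:
  assumes "f \<in> hom C A B" "g \<in> hom C A B" "Omega_arr C J f = Omega_arr C J g"
  shows "f = g"
proof -
  have A: "A \<in> Ob C" "B \<in> Ob C" using assms(1) Dom_in Cod_in by (auto simp: hom_def)
  have "(prim_path C J (Bar f), prim_path C J (Bar g)) \<in> r"
    using assms(3) Bar_hom[OF assms(1)] Bar_hom[OF assms(2)] PC.equiv
    by (auto simp: Omega_arr_def hom_def eq_equiv_class_iff)
  \<comment> \<open>On this chain the path of \<open>Bar f\<close> gives \<open>[(f, \<I>)]\<close>
    by the unit laws.\<close>
  moreover have "chain A [A] [(Id C A, \<I>)]" using A by (simp add: hom_def monoidal_simps)
  ultimately have "slide A [B] (path_act (prim_path C J (Bar f)) [(Id C A, \<I>)])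
      (path_act (prim_path C J (Bar g)) [(Id C A, \<I>)])"
    using slide_cong[of "prim_path C J (Bar f)" "prim_path C J (Bar g)" A "[(Id C A, \<I>)]"]
      homD[OF Bar_hom[OF assms(1)]] by simp
  then have "path_act (prim_path C J (Bar f)) [(Id C A, \<I>)] = path_act (prim_path C J (Bar g)) [(Id C A, \<I>)]"
    by (rule slide_short) simp
  then show ?thesis
    using assms A by (simp add: path_act_def edge_path_def prim_edge_def edge_act_def hom_def monoidal_simps)
qed

end

section \<open>Fullness\<close>

text \<open>
  Closure under composition with edges uses only that the target \<open>D\<close> is a strict monoidal category in
  which the image of \<open>J\<close> has a right dual \<open>K\<close>.
\<close>

locale dual_functor = strict_monoidal_functor C D Fo Fa + adjoin_dual C J
  for C :: "('o, 'm, 'x) mon_cat_scheme" (structure) and D :: "('p, 'n, 'y) mon_cat_scheme"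
    and Fo :: "'o \<Rightarrow> 'p" and Fa :: "'m \<Rightarrow> 'n" and J :: 'o +
  fixes K :: 'p and e h :: 'n
  assumes dual: "right_dual D (Fo J) K e h"
begin

lemma Fa_simps:
  assumes "f \<in> Ar C"
  shows "Fa f \<in> Ar D" "Dom D (Fa f) = Fo (Dom C f)" "Cod D (Fa f) = Fo (Cod C f)"
  using Fa_in[of f "Dom C f" "Cod C f"] assms by (simp_all add: hom_def)

lemma Fa_Comp_simp:
  "f \<in> Ar C \<Longrightarrow> g \<in> Ar C \<Longrightarrow> Dom C g = Cod C f \<Longrightarrow> Fa (g \<cdot> f) = Fa g \<cdot>\<^bsub>D\<^esub> Fa f"
  using Fa_Comp[of f "Dom C f" "Cod C f" g "Cod C g"] by (simp add: hom_def)

lemmas functor_simps = Fa_simps Fa_Comp_simp Fo_in Fo_TensO Fa_TensA Fo_Unit Fa_Id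

lemma dual_simps:
  "K \<in> Ob D" "e \<in> Ar D" "h \<in> Ar D" "Dom D e = Fo J \<otimes>\<^bsub>D\<^esub> K" "Cod D e = \<I>\<^bsub>D\<^esub>"
  "Dom D h = \<I>\<^bsub>D\<^esub>" "Cod D h = K \<otimes>\<^bsub>D\<^esub> Fo J"
  using dual by (auto simp: right_dual_def hom_def)

text \<open>
  \<open>nf X U m\<close> says that \<open>m\<close> is given by a chain from \<open>X\<close> to \<open>U\<close>, now with \<open>Y\<^sub>m\<close> the unit. The
  morphism described by \<open>rest Y U M\<close> has target \<open>K \<otimes> U\<^sub>0 \<otimes> K \<otimes> U\<^sub>1 \<otimes> \<dots>\<close>, which is the unit for empty \<open>U\<close>.
\<close>

inductive nf :: "'o \<Rightarrow> 'o list \<Rightarrow> 'n \<Rightarrow> bool" and rest :: "'o \<Rightarrow> 'o list \<Rightarrow> 'n \<Rightarrow> bool" where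
  nf: "B \<in> Ob C \<Longrightarrow> f \<in> hom C X (B \<otimes> Y) \<Longrightarrow> rest Y U M \<Longrightarrow>
    nf X (B # U) ((Id D (Fo B) \<boxtimes>\<^bsub>D\<^esub> M) \<cdot>\<^bsub>D\<^esub> Fa f)"
| rest_Nil: "rest \<I> [] (Id D \<I>\<^bsub>D\<^esub>)"
| rest_Cons: "Y \<in> Ob C \<Longrightarrow> nf (J \<otimes> Y) U m \<Longrightarrow>
    rest Y U ((Id D K \<boxtimes>\<^bsub>D\<^esub> m) \<cdot>\<^bsub>D\<^esub> (h \<boxtimes>\<^bsub>D\<^esub> Id D (Fo Y)))"

fun rest_ob :: "'o list \<Rightarrow> 'p" where
  "rest_ob [] = \<I>\<^bsub>D\<^esub>"
| "rest_ob (B # U) = K \<otimes>\<^bsub>D\<^esub> (Fo B \<otimes>\<^bsub>D\<^esub> rest_ob U)"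

text \<open>The object map of the expected extension of the functor from \<open>C\<close> to lists,
  with \<open>Jdual C\<close> sent to \<open>K\<close>.\<close>

definition list_ob :: "'o list \<Rightarrow> 'p" where
  "list_ob U = Fo (hd U) \<otimes>\<^bsub>D\<^esub> rest_ob (tl U)"

fun prim_arr :: "'m prim \<Rightarrow> 'n" where
  "prim_arr Eps = e"
| "prim_arr Eta = h"
| "prim_arr (Bar f) = Fa f"

lemma rest_ob_in: "set U \<subseteq> Ob C \<Longrightarrow> rest_ob U \<in> Ob D"
  by (induction U) (auto simp: dual_simps functor_simps cod.monoidal_simps)

lemma list_ob_in: "U \<in> L \<Longrightarrow> list_ob U \<in> Ob D"
  by (cases U) (auto simp: list_ob_def L_iff rest_ob_in functor_simps cod.monoidal_simps)

lemma list_ob_Cons: "T \<noteq> [] \<Longrightarrow> list_ob (t # T) = Fo t \<otimes>\<^bsub>D\<^esub> (K \<otimes>\<^bsub>D\<^esub> list_ob T)"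
  by (cases T) (auto simp: list_ob_def)

lemma list_ob_ltens:
  assumes "T \<in> L" "V \<in> L"
  shows "list_ob (T \<odot> V) = list_ob T \<otimes>\<^bsub>D\<^esub> list_ob V"
  using assms
proof (induction T)
  case Nil
  then show ?case by (simp add: L_iff)
next
  case (Cons t T)
  obtain v vs where V: "V = v # vs" "v \<in> Ob C" "set vs \<subseteq> Ob C" using Cons.prems(2) by (rule L_consE)
  show ?case
  proof (cases "T = []")
    case True
    then show ?thesis using Cons.prems V
      by (simp add: L_iff ltens_singleton list_ob_def rest_ob_in functor_simps cod.monoidal_simps)
  next
    case False
    then have "T \<in> L" "t \<in> Ob C" using Cons.prems by (auto simp: L_iff)
    then show ?thesis
      using Cons False list_ob_in[of T] list_ob_in[of V]
      by (simp add: ltens_Cons list_ob_Cons functor_simps dual_simps cod.monoidal_simps)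
  qed
qed

lemma prim_arr_simps:
  assumes "p \<in> prims C"
  shows "prim_arr p \<in> Ar D" "Dom D (prim_arr p) = list_ob (prim_dom C J p)"
    "Cod D (prim_arr p) = list_ob (prim_cod C J p)"
  using assms J_in
  by (cases p; simp add: list_ob_def ltens_def Jdual_def functor_simps dual_simps dom.monoidal_simps
      cod.monoidal_simps)+

lemma nf_typing:
  "nf X U m \<Longrightarrow> U \<in> L \<and> m \<in> Ar D \<and> Dom D m = Fo X \<and> Cod D m = list_ob U"
  "rest Y U M \<Longrightarrow> Y \<in> Ob C \<and> set U \<subseteq> Ob C \<and> M \<in> Ar D \<and> Dom D M = Fo Y \<and> Cod D M = rest_ob U"
proof (induction rule: nf_rest.inducts)
  case (nf B f X Y U M)
  then show ?case
    by (auto simp: L_iff list_ob_def hom_def functor_simps cod.monoidal_simps)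
next
  case rest_Nil
  then show ?case by (simp add: functor_simps cod.monoidal_simps)
next
  case (rest_Cons Y U m)
  then obtain u us where "U = u # us" "set us \<subseteq> Ob C" "u \<in> Ob C" by (auto elim: L_consE)
  then show ?case
    using rest_Cons J_in
    by (simp add: list_ob_def functor_simps dual_simps cod.monoidal_simps dom.monoidal_simps)
qed

lemma nf_ConsE:
  assumes "nf X (B # U) m"
  obtains f Y M where "B \<in> Ob C" "f \<in> Ar C" "Dom C f = X" "Cod C f = B \<otimes> Y" "Y \<in> Ob C"
    "set U \<subseteq> Ob C" "rest Y U M" "M \<in> Ar D" "Dom D M = Fo Y" "Cod D M = rest_ob U"
    "m = (Id D (Fo B) \<boxtimes>\<^bsub>D\<^esub> M) \<cdot>\<^bsub>D\<^esub> Fa f"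
  using assms
proof cases
  case (nf f Y M)
  then show ?thesis using that nf_typing(2)[of Y U M] by (auto simp: hom_def)
qed

lemma rest_ConsE:
  assumes "rest Y U M" "U \<noteq> []"
  obtains m where "nf (J \<otimes> Y) U m" "m \<in> Ar D" "Dom D m = Fo J \<otimes>\<^bsub>D\<^esub> Fo Y" "Cod D m = list_ob U" "Y \<in> Ob C"
    "M = (Id D K \<boxtimes>\<^bsub>D\<^esub> m) \<cdot>\<^bsub>D\<^esub> (h \<boxtimes>\<^bsub>D\<^esub> Id D (Fo Y))"
  using assms(1)
proof cases
  case (rest_Cons m)
  then show ?thesis using that[of m] nf_typing(1)[of "J \<otimes> Y" U m] J_in by (simp add: functor_simps)
qed (use assms(2) in simp)

section \<open>Closure of chain morphisms under composition with edges\<close>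

lemma nf_eqI:
  assumes "m = (Id D (Fo B) \<boxtimes>\<^bsub>D\<^esub> M) \<cdot>\<^bsub>D\<^esub> Fa f" "B \<in> Ob C" "f \<in> hom C X (B \<otimes> Y)" "rest Y U M"
  shows "nf X (B # U) m"
  using assms nf_rest.nf by blast

lemma nf_lcomp:
  assumes "nf X (w # U) m" "t \<in> Ob C" "f \<in> hom C X' (t \<otimes> X)"
  shows "nf X' ((t \<otimes> w) # U) ((Id D (Fo t) \<boxtimes>\<^bsub>D\<^esub> m) \<cdot>\<^bsub>D\<^esub> Fa f)"
proof -
  obtain g Y M where g: "w \<in> Ob C" "g \<in> Ar C" "Dom C g = X" "Cod C g = w \<otimes> Y" "Y \<in> Ob C"
    and M: "rest Y U M" "M \<in> Ar D" "Dom D M = Fo Y"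
    and m: "m = (Id D (Fo w) \<boxtimes>\<^bsub>D\<^esub> M) \<cdot>\<^bsub>D\<^esub> Fa g"
    using assms(1) by (rule nf_ConsE)
  have f: "f \<in> Ar C" "Dom C f = X'" "Cod C f = t \<otimes> X" using assms(3) by (auto simp: hom_def)
  have X: "X \<in> Ob C" using dom.Dom_in[OF g(2)] g(3) by simp
  show ?thesis
  proof (rule nf_eqI[of _ _ M "(Id C t \<boxtimes> g) \<cdot> f" _ Y])
    show "(Id D (Fo t) \<boxtimes>\<^bsub>D\<^esub> m) \<cdot>\<^bsub>D\<^esub> Fa f = (Id D (Fo (t \<otimes> w)) \<boxtimes>\<^bsub>D\<^esub> M) \<cdot>\<^bsub>D\<^esub> Fa ((Id C t \<boxtimes> g) \<cdot> f)"
      using f g M X assms(2) by (simp add: m functor_simps dom.monoidal_simps cod.monoidal_simps)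
  qed (use f g M X assms(2) in \<open>simp_all add: hom_def dom.monoidal_simps\<close>)
qed

text \<open>The counterpart of \<open>prim_act\<close> for actual morphisms: a \<open>Bar\<close> is
  absorbed into the first arrow, an \<eta> becomes a new link followed by an identity arrow, and an
  \<epsilon> cancels the first link by a triangle identity.\<close>

lemma nf_prim:
  assumes "nf X ([t] \<odot> prim_dom C J p \<odot> (w # ws)) m" "t \<in> Ob C" "w \<in> Ob C" "p \<in> prims C"
  shows "nf X ([t] \<odot> prim_cod C J p \<odot> (w # ws))
    ((Id D (Fo t) \<boxtimes>\<^bsub>D\<^esub> (prim_arr p \<boxtimes>\<^bsub>D\<^esub> Id D (list_ob (w # ws)))) \<cdot>\<^bsub>D\<^esub> m)"
proof (cases p)
  case (Bar g)
  then have g: "g \<in> Ar C" using assms by simp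
  have "nf X ((t \<otimes> Dom C g \<otimes> w) # ws) m" using assms Bar by (simp add: ltens_prim_simps)
  then obtain f Y M where f: "f \<in> Ar C" "Dom C f = X" "Cod C f = t \<otimes> Dom C g \<otimes> w \<otimes> Y" "Y \<in> Ob C"
    and ws: "set ws \<subseteq> Ob C" and M: "rest Y ws M" "M \<in> Ar D" "Dom D M = Fo Y" "Cod D M = rest_ob ws"
    and m: "m = (Id D (Fo (t \<otimes> Dom C g \<otimes> w)) \<boxtimes>\<^bsub>D\<^esub> M) \<cdot>\<^bsub>D\<^esub> Fa f" by (rule nf_ConsE)
  have "nf X ((t \<otimes> Cod C g \<otimes> w) # ws)
    ((Id D (Fo t) \<boxtimes>\<^bsub>D\<^esub> (Fa g \<boxtimes>\<^bsub>D\<^esub> Id D (list_ob (w # ws)))) \<cdot>\<^bsub>D\<^esub> m)"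
  proof (rule nf_eqI[of _ _ M "(Id C t \<boxtimes> g \<boxtimes> Id C w \<boxtimes> Id C Y) \<cdot> f" _ Y])
    show "(Id D (Fo t) \<boxtimes>\<^bsub>D\<^esub> (Fa g \<boxtimes>\<^bsub>D\<^esub> Id D (list_ob (w # ws)))) \<cdot>\<^bsub>D\<^esub> m
      = (Id D (Fo (t \<otimes> Cod C g \<otimes> w)) \<boxtimes>\<^bsub>D\<^esub> M) \<cdot>\<^bsub>D\<^esub> Fa ((Id C t \<boxtimes> g \<boxtimes> Id C w \<boxtimes> Id C Y) \<cdot> f)"
      using f g M assms(2,3) rest_ob_in[OF ws]
      by (simp add: m list_ob_def functor_simps dom.monoidal_simps cod.monoidal_simps)
  qed (use f g M assms(2,3) in \<open>simp_all add: hom_def dom.monoidal_simps\<close>)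
  then show ?thesis using assms(2,3) Bar by (simp add: ltens_prim_simps)
next
  case Eta
  have "nf X ((t \<otimes> w) # ws) m" using assms Eta by (simp add: ltens_prim_simps)
  then obtain f Y M where f: "f \<in> Ar C" "Dom C f = X" "Cod C f = t \<otimes> w \<otimes> Y" "Y \<in> Ob C"
    and ws: "set ws \<subseteq> Ob C" and M: "rest Y ws M" "M \<in> Ar D" "Dom D M = Fo Y" "Cod D M = rest_ob ws"
    and m: "m = (Id D (Fo (t \<otimes> w)) \<boxtimes>\<^bsub>D\<^esub> M) \<cdot>\<^bsub>D\<^esub> Fa f" by (rule nf_ConsE)
  \<comment> \<open>The identity arrow behind the new \<eta>, as in the clause of
    \<open>prim_act\<close> for \<open>Eta\<close>.\<close>
  have i: "nf (J \<otimes> (w \<otimes> Y)) ((J \<otimes> w) # ws) ((Id D (Fo (J \<otimes> w)) \<boxtimes>\<^bsub>D\<^esub> M) \<cdot>\<^bsub>D\<^esub> Fa (Id C (J \<otimes> w \<otimes> Y)))"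
    using f M assms(2,3) J_in by (intro nf_rest.nf[of _ _ _ Y]) (simp_all add: hom_def dom.monoidal_simps)
  have "nf X (t # (J \<otimes> w) # ws)
    ((Id D (Fo t) \<boxtimes>\<^bsub>D\<^esub> (h \<boxtimes>\<^bsub>D\<^esub> Id D (list_ob (w # ws)))) \<cdot>\<^bsub>D\<^esub> m)"
  proof (rule nf_eqI[OF _ _ _ rest_Cons[OF _ i]])
    show "(Id D (Fo t) \<boxtimes>\<^bsub>D\<^esub> (h \<boxtimes>\<^bsub>D\<^esub> Id D (list_ob (w # ws)))) \<cdot>\<^bsub>D\<^esub> m
      = (Id D (Fo t) \<boxtimes>\<^bsub>D\<^esub> ((Id D K \<boxtimes>\<^bsub>D\<^esub> ((Id D (Fo (J \<otimes> w)) \<boxtimes>\<^bsub>D\<^esub> M) \<cdot>\<^bsub>D\<^esub> Fa (Id C (J \<otimes> w \<otimes> Y))))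
        \<cdot>\<^bsub>D\<^esub> (h \<boxtimes>\<^bsub>D\<^esub> Id D (Fo (w \<otimes> Y))))) \<cdot>\<^bsub>D\<^esub> Fa f"
    proof -
      let ?k = "Id D (Fo w) \<boxtimes>\<^bsub>D\<^esub> M"
      \<comment> \<open>The new unit is created to the left of \<open>?k\<close>, so it may as well
        be created before \<open>?k\<close> is applied.\<close>
      have "(h \<boxtimes>\<^bsub>D\<^esub> Id D (Fo w \<otimes>\<^bsub>D\<^esub> rest_ob ws)) \<cdot>\<^bsub>D\<^esub> ?k
          = (Id D (K \<otimes>\<^bsub>D\<^esub> Fo J) \<boxtimes>\<^bsub>D\<^esub> ?k) \<cdot>\<^bsub>D\<^esub> (h \<boxtimes>\<^bsub>D\<^esub> Id D (Fo (w \<otimes> Y)))"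
        using cod.TensA_unit_Dom_swap[of h ?k] f M assms(3)
        by (simp add: functor_simps dual_simps cod.Comp_simps cod.Id_simps cod.TensA_simps)
      moreover have "(Id D (Fo t) \<boxtimes>\<^bsub>D\<^esub> (h \<boxtimes>\<^bsub>D\<^esub> Id D (list_ob (w # ws)))) \<cdot>\<^bsub>D\<^esub> m
          = (Id D (Fo t) \<boxtimes>\<^bsub>D\<^esub> ((h \<boxtimes>\<^bsub>D\<^esub> Id D (Fo w \<otimes>\<^bsub>D\<^esub> rest_ob ws)) \<cdot>\<^bsub>D\<^esub> ?k)) \<cdot>\<^bsub>D\<^esub> Fa f"
        using f M assms(2,3) rest_ob_in[OF ws]
        by (simp add: m list_ob_def functor_simps dual_simps dom.monoidal_simps cod.monoidal_simps)
      ultimately show ?thesis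
        using f M assms(2,3) rest_ob_in[OF ws] J_in
        by (simp add: functor_simps dual_simps dom.monoidal_simps cod.monoidal_simps)
    qed
  qed (use f M assms(2,3) in \<open>simp_all add: hom_def dom.monoidal_simps\<close>)
  then show ?thesis using assms(2,3) Eta by (simp add: ltens_prim_simps)
next
  case Eps
  have "nf X ((t \<otimes> J) # w # ws) m" using assms Eps by (simp add: ltens_prim_simps)
  then obtain f Y M where f: "f \<in> Ar C" "Dom C f = X" "Cod C f = t \<otimes> J \<otimes> Y" "Y \<in> Ob C"
    and ws: "set (w # ws) \<subseteq> Ob C" and M: "rest Y (w # ws) M" "M \<in> Ar D" "Dom D M = Fo Y"
      "Cod D M = rest_ob (w # ws)"
    and m: "m = (Id D (Fo (t \<otimes> J)) \<boxtimes>\<^bsub>D\<^esub> M) \<cdot>\<^bsub>D\<^esub> Fa f" by (rule nf_ConsE)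
  obtain n where n: "nf (J \<otimes> Y) (w # ws) n" "n \<in> Ar D" "Dom D n = Fo J \<otimes>\<^bsub>D\<^esub> Fo Y" "Cod D n = list_ob (w # ws)"
    and Mn: "M = (Id D K \<boxtimes>\<^bsub>D\<^esub> n) \<cdot>\<^bsub>D\<^esub> (h \<boxtimes>\<^bsub>D\<^esub> Id D (Fo Y))"
    using M(1) by (rule rest_ConsE) auto
  \<comment> \<open>The link \<open>M\<close> is the transpose of \<open>n\<close>, and the counit
    transposes it back.\<close>
  have tri: "(e \<boxtimes>\<^bsub>D\<^esub> Id D (Cod D n)) \<cdot>\<^bsub>D\<^esub> (Id D (Fo J) \<boxtimes>\<^bsub>D\<^esub> M) = n"
    unfolding Mn using n f by (intro cod.right_dual_transpose[OF dual]) (simp_all add: functor_simps)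
  have W: "list_ob (w # ws) \<in> Ob D" using ws by (simp add: list_ob_in L_iff)
  have "(Id D (Fo t) \<boxtimes>\<^bsub>D\<^esub> (e \<boxtimes>\<^bsub>D\<^esub> Id D (list_ob (w # ws)))) \<cdot>\<^bsub>D\<^esub> m
      = (Id D (Fo t) \<boxtimes>\<^bsub>D\<^esub> ((e \<boxtimes>\<^bsub>D\<^esub> Id D (list_ob (w # ws))) \<cdot>\<^bsub>D\<^esub> (Id D (Fo J) \<boxtimes>\<^bsub>D\<^esub> M))) \<cdot>\<^bsub>D\<^esub> Fa f"
    using f M assms(2,3) W J_in ws
    by (simp add: m list_ob_def functor_simps dual_simps dom.monoidal_simps cod.monoidal_simps)
  also have "\<dots> = (Id D (Fo t) \<boxtimes>\<^bsub>D\<^esub> n) \<cdot>\<^bsub>D\<^esub> Fa f"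
    using tri by (simp add: n)
  finally have "nf X ((t \<otimes> w) # ws) ((Id D (Fo t) \<boxtimes>\<^bsub>D\<^esub> (e \<boxtimes>\<^bsub>D\<^esub> Id D (list_ob (w # ws)))) \<cdot>\<^bsub>D\<^esub> m)"
    using nf_lcomp[OF n(1) assms(2), of f X] f assms(2) J_in by (simp add: hom_def dom.monoidal_simps)
  then show ?thesis using assms(2,3) Eps by (simp add: ltens_prim_simps)
qed

lemma nf_edge:
  assumes "nf X (T \<odot> prim_dom C J p \<odot> W) m" "T \<in> L" "W \<in> L" "p \<in> prims C"
  shows "nf X (T \<odot> prim_cod C J p \<odot> W)
    ((Id D (list_ob T) \<boxtimes>\<^bsub>D\<^esub> (prim_arr p \<boxtimes>\<^bsub>D\<^esub> Id D (list_ob W))) \<cdot>\<^bsub>D\<^esub> m)"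
  using assms
proof (induction T arbitrary: X m)
  case Nil
  then show ?case by (simp add: L_iff)
next
  case (Cons t T)
  have t: "t \<in> Ob C" using Cons.prems by (simp add: L_iff)
  show ?case
  proof (cases "T = []")
    case True
    obtain w ws where W: "W = w # ws" "w \<in> Ob C" using Cons.prems by (auto elim: L_consE)
    then show ?thesis
      using nf_prim[of X t p w ws m] Cons.prems t True
      by (simp add: list_ob_def[of "[t]"] functor_simps cod.monoidal_simps(16,17))
  next
    case False
    then have T: "T \<in> L" using Cons.prems by (auto simp: L_iff)
    let ?U = "T \<odot> prim_dom C J p \<odot> W" and ?V = "T \<odot> prim_cod C J p \<odot> W"
    let ?E = "prim_arr p \<boxtimes>\<^bsub>D\<^esub> Id D (list_ob W)"
    have "nf X (t # ?U) m" using Cons.prems False by (simp add: ltens_Cons)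
    then obtain f Y M where f: "f \<in> Ar C" "Dom C f = X" "Cod C f = t \<otimes> Y" "Y \<in> Ob C"
      and M: "rest Y ?U M" "M \<in> Ar D" "Dom D M = Fo Y"
      and m: "m = (Id D (Fo t) \<boxtimes>\<^bsub>D\<^esub> M) \<cdot>\<^bsub>D\<^esub> Fa f" by (rule nf_ConsE)
    obtain n where n: "nf (J \<otimes> Y) ?U n" "n \<in> Ar D" "Dom D n = Fo J \<otimes>\<^bsub>D\<^esub> Fo Y" "Cod D n = list_ob ?U"
      and Mn: "M = (Id D K \<boxtimes>\<^bsub>D\<^esub> n) \<cdot>\<^bsub>D\<^esub> (h \<boxtimes>\<^bsub>D\<^esub> Id D (Fo Y))"
      using M(1) by (rule rest_ConsE) auto
    have "nf X (t # ?V) ((Id D (list_ob (t # T)) \<boxtimes>\<^bsub>D\<^esub> ?E) \<cdot>\<^bsub>D\<^esub> m)"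
    \<comment> \<open>The edge lies to the right of \<open>t\<close> and of the first
      \<open>K\<close>, so it only meets the factor \<open>n\<close> of the first link and the
      induction hypothesis applies there.\<close>
    proof (rule nf_eqI[OF _ t _ rest_Cons[OF _ Cons.IH[OF n(1) T Cons.prems(3,4)]]])
      have "list_ob ?U = list_ob T \<otimes>\<^bsub>D\<^esub> (list_ob (prim_dom C J p) \<otimes>\<^bsub>D\<^esub> list_ob W)"
        using T Cons.prems by (simp add: list_ob_ltens list_ob_in cod.monoidal_simps)
      then show "(Id D (list_ob (t # T)) \<boxtimes>\<^bsub>D\<^esub> ?E) \<cdot>\<^bsub>D\<^esub> m = (Id D (Fo t) \<boxtimes>\<^bsub>D\<^esub>
          ((Id D K \<boxtimes>\<^bsub>D\<^esub> ((Id D (list_ob T) \<boxtimes>\<^bsub>D\<^esub> ?E) \<cdot>\<^bsub>D\<^esub> n)) \<cdot>\<^bsub>D\<^esub> (h \<boxtimes>\<^bsub>D\<^esub> Id D (Fo Y)))) \<cdot>\<^bsub>D\<^esub> Fa f"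
        using f n t T J_in Cons.prems False prim_arr_simps[OF Cons.prems(4)] list_ob_in[OF T] list_ob_in[OF Cons.prems(3)]
          list_ob_in[OF prim_dom_L[OF Cons.prems(4)]]
        by (simp add: m Mn list_ob_Cons functor_simps dual_simps dom.monoidal_simps cod.monoidal_simps)
    qed (use f t in \<open>simp_all add: hom_def\<close>)
    then show ?thesis using False by (simp add: ltens_Cons)
  qed
qed

lemma nf_Id: "A \<in> Ob C \<Longrightarrow> nf A [A] (Id D (Fo A))"
  by (rule nf_eqI[of _ _ "Id D \<I>\<^bsub>D\<^esub>" "Id C A" _ \<I>])
    (auto simp: hom_def functor_simps dom.monoidal_simps cod.monoidal_simps intro: rest_Nil)

lemma nf_singletonE:
  assumes "nf A [B] m"
  obtains f where "f \<in> hom C A B" "m = Fa f"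
proof -
  obtain f Y M where f: "B \<in> Ob C" "f \<in> Ar C" "Dom C f = A" "Cod C f = B \<otimes> Y" and M: "rest Y [] M"
    and m: "m = (Id D (Fo B) \<boxtimes>\<^bsub>D\<^esub> M) \<cdot>\<^bsub>D\<^esub> Fa f" using assms by (rule nf_ConsE)
  \<comment> \<open>No link can follow: \<open>rest_Cons\<close> would need a chain with the empty
    list as its target. Hence \<open>f\<close> goes to \<open>B\<close> itself.\<close>
  from M have "Y = \<I> \<and> M = Id D \<I>\<^bsub>D\<^esub>"
  proof cases
    case (rest_Cons m)
    then show ?thesis using nf_typing(1)[of "J \<otimes> Y" "[]" m] by (simp add: L_iff)
  qed simp
  then show ?thesis using f m by (intro that[of f]) (simp_all add: hom_def functor_simps dom.monoidal_simps cod.monoidal_simps)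
qed

end

section \<open>Chain morphisms in the category with \<open>J\<^sup>\<or>\<close> adjoined, and
  fullness\<close>

context adjoin_dual
begin

text \<open>Whiskering is tensoring with identities; this brings the class of an edge into the form
  used in \<open>nf_edge\<close>.\<close>

lemma class_edge_path:
  assumes "T \<in> L" "p \<in> prims C" "W \<in> L"
  shows "Id Q T \<boxtimes>\<^bsub>Q\<^esub> (r `` {prim_path C J p} \<boxtimes>\<^bsub>Q\<^esub> Id Q W) = r `` {edge_path C J (T, p, W)}"
proof -
  note p = prim_path_hom[OF assms(2)]
  have 1: "rwhisker C (prim_path C J p) W \<in> hom P (prim_dom C J p \<odot> W) (prim_cod C J p \<odot> W)"
    using p assms(3) by (rule rwhisker_hom)
  have "whisker C T (prim_path C J p) W = edge_path C J (T, p, W)"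
    using assms by (simp add: whisker_def edge_path_def prim_edge_def whisker_edge_def)
  then show ?thesis
    using Q_TensA[OF p P.Id_in, of W] Q_TensA[OF P.Id_in 1, of T] path_tens_Id_right[OF p assms(3)]
      path_tens_Id_left[OF 1 assms(1)] whisker_whisker[OF p, of "[\<I>]" W T "[\<I>]"] assms
    by (simp del: free_category_simps(5,6))
qed

lemma Omega_full:
  assumes "F \<in> hom Q [A] [B]"
  obtains f where "f \<in> hom C A B" "F = Omega_arr C J f"
proof -
  interpret Omega: dual_functor C Q Omega_ob "Omega_arr C J" J "Jdual C"
    "r `` {prim_path C J Eps}" "r `` {prim_path C J Eta}"
    using right_dual_adjoin_right_dual
    by (intro dual_functor.intro strict_monoidal_Omega adjoin_dual_axioms dual_functor_axioms.intro)
      (simp add: Omega_ob_def)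
  \<comment> \<open>Here the target of a chain is the list itself, by the decomposition of a list
    into objects of \<open>C\<close> and copies of \<open>Jdual C\<close>. The leading \<I> is the
    first entry of \<open>Jdual C\<close>.\<close>
  have rest_ob: "Omega.rest_ob U = \<I> # U" if "set U \<subseteq> Ob C" for U
    using that by (induction U) (simp_all, simp_all add: Omega_ob_def ltens_def Jdual_def monoidal_simps)
  have list_ob: "Omega.list_ob U = U" if "U \<in> L" for U
    using that by (elim L_consE) (simp add: Omega.list_ob_def rest_ob Omega_ob_def ltens_def monoidal_simps)
  have prim_arr: "Omega.prim_arr p = r `` {prim_path C J p}" for p
    by (cases p) (simp_all add: Omega_arr_def)
  \<comment> \<open>Edges are composed on at the target, so the induction removes the last edge of
    the path and starts from the normal form of the identity.\<close>
  have path: "Omega.nf A V (r `` {([A], es, V)})" if "G.awalk [A] es V" "A \<in> Ob C" for es V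
    using that
  proof (induction es arbitrary: V rule: rev_induct)
    case Nil
    then show ?case using Omega.nf_Id[of A] by (simp add: G.awalk_Nil_iff Omega_ob_def[of A])
  next
    case (snoc a es)
    obtain T p W where a: "a = (T, p, W)" by (cases a)
    have w: "G.awalk [A] es (tail G a)" "a \<in> arcs G" "V = head G a"
      using snoc.prems by (auto simp: G.awalk_append_iff G.awalk_Cons_iff G.awalk_Nil_iff)
    have c: "r `` {edge_path C J a} \<cdot>\<^bsub>Q\<^esub> r `` {([A], es, tail G a)} = r `` {([A], es @ [a], V)}"
      using PC.quotient_Comp[of "([A], es, tail G a)" "[A]" "tail G a" "edge_path C J a" "head G a"]
        edge_path_hom[OF w(2)] w
      by (simp add: P_hom_iff edge_path_def)
    show ?case
      using Omega.nf_edge[of A T p W "r `` {([A], es, tail G a)}"] snoc.IH[OF w(1) snoc.prems(2)] w c a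
        class_edge_path[of T p W]
      by (simp add: list_ob prim_arr)
  qed
  obtain q where q: "q \<in> hom P [A] [B]" "F = r `` {q}"
    using assms by (auto elim!: PC.quotient_homE)
  then obtain es where "q = ([A], es, [B])" "G.awalk [A] es [B]" "A \<in> Ob C" by (auto elim: P_homE)
  then show ?thesis
    using path Omega.nf_singletonE q that by metis
qed

end

theorem theorem17:
  fixes C :: "('o, 'm) mon_cat" and J :: 'o
  assumes "strict_monoidal_category C"
    and "J \<in> Ob C"
  shows "fully_faithful_functor C (adjoin_right_dual C J) Omega_ob (Omega_arr C J)"
proof -
  interpret adjoin_dual C J
    using assms by (simp add: adjoin_dual_def adjoin_dual_axioms_def)
  interpret Omega: strict_monoidal_functor C Q Omega_ob "Omega_arr C J"
    by (rule strict_monoidal_Omega)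
  have "bij_betw (Omega_arr C J) (hom C A B) (hom Q (Omega_ob A) (Omega_ob B))" for A B
    unfolding bij_betw_def
  proof
    show "inj_on (Omega_arr C J) (hom C A B)"
      using Omega_faithful by (rule inj_onI)
    show "Omega_arr C J ` hom C A B = hom Q (Omega_ob A) (Omega_ob B)"
      using Omega.Fa_in Omega_full[of _ A B] unfolding Omega_ob_def by blast
  qed
  then show ?thesis
    unfolding fully_faithful_functor_def using Omega.cat_functor_axioms by blast
qed

end
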